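(* Let $I=\sum_{i=1}^\infty q_i\prod_{j=i+1}^{i+\ell}p_j$. The following hold: (i) For every integer $n\ge 1$, $\displaystyle \mathbb{P}(D=n+1)=q_n\,\mathbb{P}(D>n-\ell)\prod_{j=n+1}^{n+\ell}p_j$. (ii) If $\sum_{i=1}^\infty q_i<\infty$ or $I=\infty$, then $D<\infty$ almost surely. Otherwise $\mathbb{P}(D=\infty)>0$. (iii) If $\displaystyle\limsup_{i\to\infty}\frac{-\log p_i}{\log i}<\frac1\ell$, then $I=\infty$; and if $\displaystyle\liminf_{i\to\infty}\frac{-\log p_i}{\log i}>\frac1\ell$, then $I<\infty$. (iv) Let $n\ge\ell$ be a fixed integer. If $p_i\to 1$ as $i\to\infty$, then $D$ is short-tailed, i.e. $\mathbb{P}(D>i+n)/\mathbb{P}(D>i)\to 0$ as $i\to\infty$; if $p_i\to 0$ as $i\to\infty$, then $D$ is long-tailed, i.e. $\mathbb{P}(D>i+n)/\mathbb{P}(D>i)\to 1$ as $i\to\infty$. (v) In the homogeneous case $p_i\equiv p\in(0,1)$, $\mathbb{P}(D>n)\sim c_1 z^{-n}$ as $n\to\infty$ for some constant $c_1\in(0,\infty)$, where $z>0$ solves $(1-p)z\sum_{i=0}^{\ell-1}(pz)^i=1$. (vi) (Short tail) If $p_i=\exp(-a i^{-b})$ for all $i$, with $a,b>0$, then $\mathbb{P}(D>n)\approx_{\log}\exp(-bn\log n/\ell)$ as $n\to\infty$. (vii) (Long tail) If $p_i=i^{-b}$ for all $i\ge 2$ (and $p_1\in(0,1)$), with $b\in(0,1/\ell)$,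 then $\mathbb{P}(D>n)\approx_{\log}\exp\{-n^{1-b\ell}/(1-b\ell)\}$ as $n\to\infty$.
   Context: Let $\xi_1,\xi_2,\ldots$ be a (non-stationary) sequence of independent Bernoulli ($\{0,1\}$-valued) random variables with $\mathbb{P}(\xi_i=1)=p_i$, where $0<p_i<1$ for all $i$, and write $q_i=1-p_i$. For a fixed integer $\ell\ge 1$, let $D=\min\{n\ge 1:\ \xi_n=\xi_{n+1}=\cdots=\xi_{n+\ell-1}=1\}$ be the time of the first run of $\ell$ ones, with $D=\infty$ if there is no such run. The relation $f(n)\sim g(n)$ means $f(n)/g(n)\to 1$ as $n\to\infty$, and $f(n)\approx_{\log} g(n)$ means $\log f(n)/\log g(n)\to 1$ as $n\to\infty$.
   Formalization: In (iii), the first implication is proved under the added hypothesis that the sum of q_i diverges; without it the claim is false, e.g. for p_i = 1 - 2^{-(i+1)}, and whenever the sum of q_i converges, I is finite. *)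

theory Defs
  imports "HOL-Probability.Probability" "HOL-Real_Asymp.Real_Asymp"
begin

text \<open>Sequences are indexed from 1; their value at index 0 is never used.\<close>

definition bernoulli_seq :: "'a measure \<Rightarrow> (nat \<Rightarrow> 'a \<Rightarrow> nat) \<Rightarrow> (nat \<Rightarrow> real) \<Rightarrow> bool" where
  "bernoulli_seq M \<xi> p \<longleftrightarrow>
     prob_space M \<and>
     prob_space.indep_vars M (\<lambda>_. count_space UNIV) \<xi> {1..} \<and>
     (\<forall>i\<ge>1. \<forall>\<omega>\<in>space M. \<xi> i \<omega> \<in> {0, 1}) \<and>
     (\<forall>i\<ge>1. \<P>(\<omega> in M. \<xi> i \<omega> = 1) = p i)"

text \<open>The infimum of the empty set in \<^typ>\<open>enat\<close> is \<open>\<infinity>\<close>, and a nonempty infimum is attained.\<close>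

definition first_run :: "(nat \<Rightarrow> 'a \<Rightarrow> nat) \<Rightarrow> nat \<Rightarrow> 'a \<Rightarrow> enat" where
  "first_run \<xi> l \<omega> = Inf (enat ` {n. n \<ge> 1 \<and> (\<forall>j\<in>{n..n+l-1}. \<xi> j \<omega> = 1)})"

definition run_tail :: "'a measure \<Rightarrow> (nat \<Rightarrow> 'a \<Rightarrow> nat) \<Rightarrow> nat \<Rightarrow> nat \<Rightarrow> real" where
  "run_tail M \<xi> l n = \<P>(\<omega> in M. first_run \<xi> l \<omega> > enat n)"

text \<open>The shift by \<^const>\<open>Suc\<close> makes the sum start at \<open>i = 1\<close>.\<close>

definition run_series :: "(nat \<Rightarrow> real) \<Rightarrow> nat \<Rightarrow> ennreal" where
  "run_series p l =
     (\<Sum>k. let i = Suc k in ennreal ((1 - p i) * (\<Prod>j\<in>{i+1..i+l}. p j)))"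

definition log_equiv :: "(nat \<Rightarrow> real) \<Rightarrow> (nat \<Rightarrow> real) \<Rightarrow> bool"  (infix "\<approx>log" 50) where
  "f \<approx>log g \<longleftrightarrow> (\<lambda>n. ln (f n) / ln (g n)) \<longlonglongrightarrow> 1"

text \<open>A bound on the upper growth exponent of \<open>- ln (p i)\<close> does not by itself force
  \<open>run_series p l = \<infinity>\<close>: the series converges whenever \<open>\<Sum>i. 1 - p i\<close> does. The upper-exponent
  criterion therefore has to be restricted to the case in which \<open>\<Sum>i. 1 - p i\<close> diverges.\<close>

lemma limsup_criterion_fails_if_summable:
  assumes "l \<ge> 1"
  shows "\<exists>p :: nat \<Rightarrow> real. (\<forall>i. 0 < p i \<and> p i < 1) \<and>
    limsup (\<lambda>i. ereal (- ln (p i) / ln (real i))) < ereal (1 / real l) \<and>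
    run_series p l < \<infinity>"
proof -
  define p :: "nat \<Rightarrow> real" where "p i = 1 - (1/2) ^ Suc i" for i
  have p01: "0 < p i \<and> p i < 1" for i
  proof -
    have "(1/2 :: real) ^ Suc i \<le> (1/2) ^ 1"
      by (intro power_decreasing) auto
    then show ?thesis unfolding p_def by simp
  qed
  have "(\<lambda>i. - ln (p i) / ln (real i)) \<longlonglongrightarrow> 0"
    unfolding p_def by real_asymp
  then have "(\<lambda>i. ereal (- ln (p i) / ln (real i))) \<longlonglongrightarrow> ereal 0"
    by simp
  then have "limsup (\<lambda>i. ereal (- ln (p i) / ln (real i))) = ereal 0"
    by (intro lim_imp_Limsup) auto
  then have limsup: "limsup (\<lambda>i. ereal (- ln (p i) / ln (real i))) < ereal (1 / real l)"
    using assms by simp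
  have "run_series p l \<le> (\<Sum>k. ennreal ((1/2) ^ Suc (Suc k)))"
    unfolding run_series_def Let_def
  proof (intro suminf_le ennreal_leI)
    fix k
    have "(\<Prod>j\<in>{Suc k + 1..Suc k + l}. p j) \<le> 1"
      by (intro prod_le_1) (use p01 less_imp_le in blast)
    then have "(1 - p (Suc k)) * (\<Prod>j\<in>{Suc k + 1..Suc k + l}. p j) \<le> (1 - p (Suc k)) * 1"
      using p01[of "Suc k"] by (intro mult_left_mono) auto
    then show "(1 - p (Suc k)) * (\<Prod>j\<in>{Suc k + 1..Suc k + l}. p j) \<le> (1/2) ^ Suc (Suc k)"
      by (simp add: p_def)
  qed auto
  also have "\<dots> < \<infinity>"
  proof -
    have "summable (\<lambda>k. (1/2 :: real) ^ Suc (Suc k))"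
      by (subst summable_Suc_iff, subst summable_Suc_iff) (simp add: summable_geometric)
    then have "(\<Sum>k. ennreal ((1/2) ^ Suc (Suc k))) = ennreal (\<Sum>k. (1/2) ^ Suc (Suc k))"
      by (intro suminf_ennreal2) auto
    then show ?thesis by simp
  qed
  finally show ?thesis using p01 limsup by blast
qed

end

theory Submission
  imports Defs
begin

text \<open>
  Write \<open>t n\<close> for the probability of \<open>D > n\<close> and \<open>w n\<close> for the \<open>n\<close>-th term of the series
  \<open>I\<close>. If the first run starts at \<open>n + 1 > 1\<close>, there is a zero at \<open>n\<close>; this zero alone rules
  out the starting points \<open>n - l + 1, \<dots>, n\<close>, while the event that no run starts at or before
  \<open>n - l\<close> concerns only variables with index below \<open>n\<close>. Independence then gives (i), that is,
  the recursion \<open>t (n + 1) = t n - w n * t (n - l)\<close> (\<open>tail_Suc\<close>), in which the truncated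
  difference is the right one because \<open>t 0 = 1\<close>. In the same way, a zero at \<open>n\<close>, or a run
  starting at \<open>n\<close>, gives the bounds
  \<open>1 - p n \<le> t n / t (n - l) \<le> 1 - p n * \<dots> * p (n + l - 1)\<close> (\<open>tail_ge\<close>, \<open>tail_le\<close>).
  Everything else is analysis of these three facts.

  For (ii), the limit of \<open>t\<close> is the probability of \<open>D = \<infinity>\<close>. If the series of \<open>1 - p n\<close>
  converges, \<open>p\<close> tends to \<open>1\<close> and the upper bound makes this limit zero. If the limit is
  positive, summing the recursion shows that the series of \<open>w\<close> converges. Conversely, if it is zero and that series
  converges, the ratios \<open>t n / t (n - l)\<close> tend to \<open>0\<close>, hence so does \<open>1 - p n\<close>, and then the
  series of \<open>1 - p n\<close> converges as well (\<open>tail_limit_pos\<close>). The delicate half of (iii) is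
  \<open>series_infinite_if_slow_decay\<close>: unless \<open>p\<close> tends to \<open>1\<close>, convergence would make the
  indices where \<open>1 - p n\<close> is not small so dense that a divergent series of powers bounds the
  given one from below. Part (iv) is read off from the two bounds.

  In the homogeneous case the recursion integrates once to a renewal equation, and (v) follows
  from the convergence of sequences whose terms are weighted means of their \<open>l\<close> predecessors
  (\<open>mean_recursion_converges\<close>). Parts (vi) and (vii) compute the increments of \<open>ln (t n)\<close>, from
  the two bounds and from the recursion respectively, and sum them by the Stolz--Cesaro theorem.
\<close>

section \<open>Two limit principles for real sequences\<close>

text \<open>The Stolz--Cesaro theorem. With \<open>z = x - L y\<close> the hypothesis says that the increments of
  \<open>z\<close> are negligible against those of \<open>y\<close>; summing them shows that \<open>z\<close> is negligible
  against \<open>y\<close>, because the contribution of the initial segment is constant while \<open>y\<close> diverges.\<close>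

lemma stolz_cesaro:
  fixes x y :: "nat \<Rightarrow> real"
  assumes inc: "\<And>n. n \<ge> n0 \<Longrightarrow> y n < y (Suc n)"
    and top: "filterlim y at_top sequentially"
    and lim: "(\<lambda>n. (x (Suc n) - x n) / (y (Suc n) - y n)) \<longlonglongrightarrow> L"
  shows "(\<lambda>n. x n / y n) \<longlonglongrightarrow> L"
proof (rule LIMSEQ_I)
  fix e :: real assume e: "e > 0"
  define z where "z n = x n - L * y n" for n
  obtain N0 where N0: "\<And>n. n \<ge> N0 \<Longrightarrow>
      \<bar>(x (Suc n) - x n) / (y (Suc n) - y n) - L\<bar> < e / 2"
    using LIMSEQ_D[OF lim, of "e / 2"] e by auto
  define N where "N = max n0 N0"
  have incr: "\<bar>z (Suc n) - z n\<bar> \<le> e / 2 * (y (Suc n) - y n)" if "n \<ge> N" for n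
  proof -
    have pos: "y (Suc n) - y n > 0" using inc[of n] that by (simp add: N_def)
    have "z (Suc n) - z n = ((x (Suc n) - x n) / (y (Suc n) - y n) - L) * (y (Suc n) - y n)"
      using pos by (simp add: z_def field_simps)
    then have "\<bar>z (Suc n) - z n\<bar> =
        \<bar>(x (Suc n) - x n) / (y (Suc n) - y n) - L\<bar> * (y (Suc n) - y n)"
      using pos by (simp add: abs_mult)
    then show ?thesis using N0[of n] that pos by (simp add: N_def mult_right_mono)
  qed
  have z_bound: "\<bar>z n - z N\<bar> \<le> e / 2 * (y n - y N)" if "n \<ge> N" for n
    using that
  proof (induction n rule: dec_induct)
    case (step n)
    have "\<bar>z (Suc n) - z N\<bar> \<le> \<bar>z (Suc n) - z n\<bar> + \<bar>z n - z N\<bar>" by simp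
    also have "\<dots> \<le> e / 2 * (y (Suc n) - y n) + e / 2 * (y n - y N)"
      using step incr[of n] by (intro add_mono) auto
    also have "\<dots> = e / 2 * (y (Suc n) - y N)" by (simp add: field_simps)
    finally show ?case .
  qed simp
  have "eventually (\<lambda>n. y n \<ge> max 1 (2 / e * (\<bar>z N\<bar> + e / 2 * \<bar>y N\<bar> + 1))) sequentially"
    using top unfolding filterlim_at_top by blast
  then obtain K where K: "\<And>n. n \<ge> K \<Longrightarrow> y n \<ge> max 1 (2 / e * (\<bar>z N\<bar> + e / 2 * \<bar>y N\<bar> + 1))"
    by (auto simp: eventually_sequentially)
  show "\<exists>no. \<forall>n\<ge>no. norm (x n / y n - L) < e"
  proof (intro exI allI impI)
    fix n assume n: "n \<ge> max N K"
    have y: "y n \<ge> 1" "y n \<ge> 2 / e * (\<bar>z N\<bar> + e / 2 * \<bar>y N\<bar> + 1)" using K[of n] n by auto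
    have "e / 2 * y n \<ge> e / 2 * (2 / e * (\<bar>z N\<bar> + e / 2 * \<bar>y N\<bar> + 1))"
      using y(2) e by (intro mult_left_mono) auto
    then have "e / 2 * y n \<ge> \<bar>z N\<bar> + e / 2 * \<bar>y N\<bar> + 1" using e by simp
    moreover have "- (e / 2 * y N) \<le> e / 2 * \<bar>y N\<bar>"
      using e by (simp add: abs_if)
    moreover have "\<bar>z n - z N\<bar> \<le> e / 2 * y n - e / 2 * y N"
      using z_bound[of n] n by (simp add: right_diff_distrib)
    ultimately have "\<bar>z n\<bar> < e * y n" by linarith
    moreover have "x n / y n - L = z n / y n" using y by (simp add: z_def field_simps)
    ultimately show "norm (x n / y n - L) < e"
      using y by (simp add: field_simps)
  qed
qed

lemma weighted_mean_le:
  fixes f v :: "nat \<Rightarrow> real"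
  assumes "\<And>i. i < l \<Longrightarrow> 0 < f i" "(\<Sum>i<l. f i) = 1" "\<And>i. i < l \<Longrightarrow> v i \<le> B" "k < l"
  shows "(\<Sum>i<l. f i * v i) \<le> B - f k * (B - v k)"
proof -
  have "f k * (B - v k) \<le> (\<Sum>i<l. f i * (B - v i))"
    using assms by (intro member_le_sum mult_nonneg_nonneg) (auto intro: less_imp_le)
  also have "\<dots> = B - (\<Sum>i<l. f i * v i)"
    using assms(2) by (simp add: right_diff_distrib sum_subtractf flip: sum_distrib_right)
  finally show ?thesis by simp
qed

text \<open>An elementary renewal theorem: a positive sequence in which every term is a fixed weighted
  mean of its \<open>l\<close> predecessors converges. The maximum over a window of length \<open>l\<close> decreases. Every
  term of the following window is, within two steps, an average that gives a fixed weight to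
  \<open>u n\<close>; hence any gap between the maximum and \<open>u n\<close> lowers the maximum by a fixed proportion of
  the gap. As the maximum converges, the gap tends to zero.\<close>

lemma mean_recursion_converges:
  fixes f u :: "nat \<Rightarrow> real"
  assumes l: "l \<ge> 1" and f: "\<And>i. i < l \<Longrightarrow> 0 < f i" "(\<Sum>i<l. f i) = 1"
    and rec: "\<And>n. u (n + l) = (\<Sum>i<l. f i * u (n + i))"
    and pos: "\<And>n. 0 < u n"
  shows "\<exists>c>0. u \<longlonglongrightarrow> c"
proof -
  define B where "B n = Max (u ` {n..<n + l})" for n
  define b where "b = Min (u ` {..<l})"
  define d where "d = Min (f ` {..<l})"
  have ne: "{n..<n + l} \<noteq> {}" "{..<l} \<noteq> {}" for n using l by (auto simp: lessThan_empty_iff)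
  have window: "u k \<le> B n" if "k \<in> {n..<n + l}" for n k
    unfolding B_def using that by (intro Max_ge) auto
  have le_B: "u k \<le> B n" if "n \<le> k" for n k
    using that
  proof (induction k rule: less_induct)
    case (less k)
    show ?case
    proof (cases "k < n + l")
      case False
      then have m: "k = (k - l) + l" "n \<le> k - l" by auto
      have "(\<Sum>i<l. f i * u (k - l + i)) \<le> B n - f 0 * (B n - u (k - l + 0))"
        using less m l by (intro weighted_mean_le f) auto
      moreover have "f 0 * (B n - u (k - l + 0)) \<ge> 0"
        using less m l f(1)[of 0] by (intro mult_nonneg_nonneg) auto
      ultimately show ?thesis using rec[of "k - l"] m by simp
    qed (use less window in auto)
  qed
  have B_leI: "B n \<le> y" if "\<And>k. k \<in> {n..<n + l} \<Longrightarrow> u k \<le> y" for n y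
    unfolding B_def using that ne(1)[of n] by (intro Max.boundedI) auto
  have "decseq B"
    unfolding decseq_Suc_iff using le_B by (auto intro!: B_leI)
  then obtain c where c: "B \<longlonglongrightarrow> c"
    using decseq_convergent[of B 0] le_B pos by (metis less_imp_le order_trans order_refl)
  have d: "0 < d" "\<And>i. i < l \<Longrightarrow> d \<le> f i"
    unfolding d_def using f(1) ne(2) by auto
  have d_le_1: "d \<le> 1"
  proof -
    have "f 0 \<le> (\<Sum>i<l. f i)" using l f(1) by (intro member_le_sum) (auto intro: less_imp_le)
    then show ?thesis using d(2)[of 0] f(2) l by auto
  qed
  have drop: "B (n + l) \<le> B n - d * d * (B n - u n)" for n
  proof (rule B_leI)
    have gap: "0 \<le> B n - u n" using le_B[of n n] by simp
    have "u (n + l) \<le> B n - f 0 * (B n - u (n + 0))"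
      unfolding rec using l by (intro weighted_mean_le f le_B) auto
    moreover have "d * (B n - u n) \<le> f 0 * (B n - u n)"
      using d(2)[of 0] l gap by (intro mult_right_mono) auto
    ultimately have step1: "u (n + l) \<le> B n - d * (B n - u n)" by simp
    fix k assume k: "k \<in> {n + l..<n + l + l}"
    show "u k \<le> B n - d * d * (B n - u n)"
    proof (cases "k = n + l")
      case True
      have "d * d * (B n - u n) \<le> 1 * d * (B n - u n)"
        using d d_le_1 gap by (intro mult_right_mono) auto
      then show ?thesis using step1 True by simp
    next
      case False
      define j where "j = k - (n + l)"
      have j: "k = (n + j) + l" "0 < j" "j < l" using k False by (auto simp: j_def)
      have "u k \<le> B n - f (l - j) * (B n - u (n + j + (l - j)))"
        unfolding j(1) rec using j by (intro weighted_mean_le f le_B) auto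
      moreover have "d * (d * (B n - u n)) \<le> f (l - j) * (B n - u (n + j + (l - j)))"
        using d(1) d(2)[of "l - j"] step1 gap j by (intro mult_mono) auto
      ultimately show ?thesis by (simp add: mult.assoc)
    qed
  qed
  have "u \<longlonglongrightarrow> c"
  proof (rule tendsto_sandwich)
    show "\<forall>\<^sub>F n in sequentially. B n - (B n - B (n + l)) / (d * d) \<le> u n"
      using drop d(1) by (intro always_eventually allI) (simp add: field_simps)
    show "\<forall>\<^sub>F n in sequentially. u n \<le> B n" using le_B by simp
    have "(\<lambda>n. B n - (B n - B (n + l)) / (d * d)) \<longlonglongrightarrow> c - (c - c) / (d * d)"
      using d(1) by (intro tendsto_intros c LIMSEQ_ignore_initial_segment) auto
    then show "(\<lambda>n. B n - (B n - B (n + l)) / (d * d)) \<longlonglongrightarrow> c" by simp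
  qed (rule c)
  moreover have "b \<le> u n" for n
  proof (induction n rule: less_induct)
    case (less n)
    show ?case
    proof (cases "n < l")
      case False
      then obtain m where m: "n = m + l" by (metis le_Suc_ex add.commute not_less)
      have "b = (\<Sum>i<l. f i * b)" using f(2) by (simp flip: sum_distrib_right)
      also have "\<dots> \<le> u n"
        unfolding m rec using less m f(1) by (intro sum_mono mult_left_mono) (auto intro: less_imp_le)
      finally show ?thesis .
    qed (auto simp: b_def)
  qed
  then have "b \<le> c" using \<open>u \<longlonglongrightarrow> c\<close> by (intro LIMSEQ_le_const) auto
  moreover have "0 < b" unfolding b_def using ne(2) pos by (subst Min_gr_iff) auto
  ultimately show ?thesis by (intro exI[of _ c]) simp
qed


section \<open>The first run and its tail probabilities\<close>

locale bernoulli_runs = prob_space M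
  for M :: "'a measure" +
  fixes \<xi> :: "nat \<Rightarrow> 'a \<Rightarrow> nat" and p :: "nat \<Rightarrow> real" and l :: nat
  assumes indep: "indep_vars (\<lambda>_. count_space UNIV) \<xi> {1..}"
    and prob_one: "\<And>i. i \<ge> 1 \<Longrightarrow> prob {\<omega> \<in> space M. \<xi> i \<omega> = 1} = p i"
    and p_pos: "\<And>i. i \<ge> 1 \<Longrightarrow> 0 < p i"
    and p_less_1: "\<And>i. i \<ge> 1 \<Longrightarrow> p i < 1"
    and l_pos: "l \<ge> 1"
begin

definition no_run :: "nat \<Rightarrow> (nat \<Rightarrow> nat) \<Rightarrow> bool" where
  "no_run n x \<longleftrightarrow> (\<forall>s\<in>{1..n}. \<exists>j\<in>{s..s + l - 1}. x j \<noteq> 1)"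

abbreviation t :: "nat \<Rightarrow> real" where
  "t \<equiv> run_tail M \<xi> l"

text \<open>The general term of the series \<open>I\<close>: the probability that a zero in position \<open>n\<close> is
  followed by a run of length \<open>l\<close>.\<close>

definition w :: "nat \<Rightarrow> real" where
  "w n = (1 - p n) * (\<Prod>j\<in>{n+1..n+l}. p j)"

lemma first_run_gt_iff: "enat n < first_run \<xi> l \<omega> \<longleftrightarrow> no_run n (\<lambda>j. \<xi> j \<omega>)"
proof -
  let ?S = "{n. n \<ge> 1 \<and> (\<forall>j\<in>{n..n+l-1}. \<xi> j \<omega> = 1)}"
  have "enat n < first_run \<xi> l \<omega> \<longleftrightarrow> enat (Suc n) \<le> first_run \<xi> l \<omega>"
    by (simp add: Suc_ile_eq)
  also have "\<dots> \<longleftrightarrow> (\<forall>s\<in>?S. Suc n \<le> s)"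
    unfolding first_run_def le_Inf_iff by auto
  also have "\<dots> \<longleftrightarrow> no_run n (\<lambda>j. \<xi> j \<omega>)"
    unfolding no_run_def by (auto simp: not_less_eq_eq)
  finally show ?thesis .
qed

lemma run_tail_eq: "t n = prob {\<omega> \<in> space M. no_run n (\<lambda>j. \<xi> j \<omega>)}"
  unfolding run_tail_def first_run_gt_iff ..

lemma no_run_0 [simp]: "no_run 0 x"
  unfolding no_run_def by simp

lemma no_run_mono: "m \<le> n \<Longrightarrow> no_run n x \<Longrightarrow> no_run m x"
  unfolding no_run_def by auto

lemma no_run_ex_zero: "no_run n x \<Longrightarrow> n \<ge> 1 \<Longrightarrow> \<exists>j\<in>{n..n + l - 1}. x j \<noteq> 1"
  unfolding no_run_def by simp

lemma no_run_Suc: "no_run (Suc n) x \<longleftrightarrow> no_run n x \<and> (\<exists>j\<in>{n+1..n+l}. x j \<noteq> 1)"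
  unfolding no_run_def by (auto simp: atLeastAtMostSuc_conv)

lemma no_run_if_zero:
  assumes "x n \<noteq> 1" "no_run (n - l) x"
  shows "no_run n x"
  unfolding no_run_def
proof
  fix s assume s: "s \<in> {1..n}"
  show "\<exists>j\<in>{s..s + l - 1}. x j \<noteq> 1"
  proof (cases "s \<le> n - l")
    case True
    then show ?thesis using assms(2) s unfolding no_run_def by auto
  next
    case False
    then show ?thesis using assms(1) s l_pos by (intro bexI[of _ n]) auto
  qed
qed

lemma no_run_cong_past:
  assumes "\<And>j. j \<in> {1..<n} \<Longrightarrow> x j = y j"
  shows "no_run (n - l) x \<longleftrightarrow> no_run (n - l) y"
proof -
  have "x j = y j" if "s \<in> {1..n - l}" "j \<in> {s..s + l - 1}" for s j
    using that l_pos by (intro assms) auto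
  then show ?thesis unfolding no_run_def by (intro ball_cong bex_cong refl) simp
qed

text \<open>A zero must precede the first run, unless the run starts at \<open>1\<close>; that zero forbids the
  \<open>l\<close> preceding starting points by itself, so only starting points up to \<open>n - l\<close> remain to be
  excluded.\<close>

lemma first_run_eq_iff:
  assumes "n \<ge> 1"
  shows "first_run \<xi> l \<omega> = enat (n + 1) \<longleftrightarrow>
    no_run (n - l) (\<lambda>j. \<xi> j \<omega>) \<and> (\<xi> n \<omega> \<noteq> 1 \<and> (\<forall>j\<in>{n+1..n+l}. \<xi> j \<omega> = 1))"
    (is "_ \<longleftrightarrow> ?R")
proof -
  let ?x = "\<lambda>j. \<xi> j \<omega>"
  have "first_run \<xi> l \<omega> = enat (n + 1) \<longleftrightarrow>
      enat n < first_run \<xi> l \<omega> \<and> \<not> enat (Suc n) < first_run \<xi> l \<omega>"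
    by (cases "first_run \<xi> l \<omega>") auto
  also have "\<dots> \<longleftrightarrow> no_run n ?x \<and> (\<forall>j\<in>{n+1..n+l}. ?x j = 1)"
    unfolding first_run_gt_iff no_run_Suc by blast
  also have "\<dots> \<longleftrightarrow> ?R"
  proof
    assume *: "no_run n ?x \<and> (\<forall>j\<in>{n+1..n+l}. ?x j = 1)"
    have "?x n \<noteq> 1"
    proof
      assume "?x n = 1"
      have "?x j = 1" if "j \<in> {n..n + l - 1}" for j
      proof (cases "j = n")
        case False
        with that have "j \<in> {n+1..n+l}" by auto
        with * show ?thesis by blast
      qed (use \<open>?x n = 1\<close> in simp)
      moreover have "\<exists>j\<in>{n..n + l - 1}. ?x j \<noteq> 1"
        using no_run_ex_zero[of n ?x] * assms by simp
      ultimately show False by blast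
    qed
    moreover have "no_run (n - l) ?x" using * no_run_mono[of "n - l" n] by simp
    ultimately show ?R using * by blast
  next
    assume ?R
    then show "no_run n ?x \<and> (\<forall>j\<in>{n+1..n+l}. ?x j = 1)"
      using no_run_if_zero[of ?x n] by blast
  qed
  finally show ?thesis .
qed


subsection \<open>Independence\<close>

lemma random_variable_xi: "i \<ge> 1 \<Longrightarrow> random_variable (count_space UNIV) (\<xi> i)"
  using indep unfolding indep_vars_def by auto

lemma PiM_discrete:
  "finite A \<Longrightarrow> PiM A (\<lambda>_. count_space UNIV :: nat measure) = count_space (\<Pi>\<^sub>E i\<in>A. UNIV)"
  by (rule count_space_PiM_finite) auto

text \<open>An event described by finitely many of the variables is the preimage of a set in a countable
  discrete product space, so that neither measurability nor independence requires any property of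
  the description itself.\<close>

lemma event_finite:
  assumes "finite A" "A \<subseteq> {1..}" and "\<And>x y. (\<And>j. j \<in> A \<Longrightarrow> x j = y j) \<Longrightarrow> P x = P y"
  shows "{\<omega> \<in> space M. P (\<lambda>j. \<xi> j \<omega>)} \<in> events"
proof -
  let ?r = "\<lambda>\<omega>. restrict (\<lambda>j. \<xi> j \<omega>) A"
  have "?r \<in> measurable M (PiM A (\<lambda>_. count_space UNIV))"
    using assms(2) by (intro measurable_restrict random_variable_xi) auto
  moreover have "{x \<in> (\<Pi>\<^sub>E i\<in>A. UNIV). P x} \<in> sets (PiM A (\<lambda>_. count_space (UNIV :: nat set)))"
    unfolding PiM_discrete[OF assms(1)] by auto
  ultimately have "?r -` {x \<in> (\<Pi>\<^sub>E i\<in>A. UNIV). P x} \<inter> space M \<in> events"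
    by (rule measurable_sets)
  moreover have "P (?r \<omega>) = P (\<lambda>j. \<xi> j \<omega>)" for \<omega>
    by (rule assms(3)) simp
  then have "?r -` {x \<in> (\<Pi>\<^sub>E i\<in>A. UNIV). P x} \<inter> space M = {\<omega> \<in> space M. P (\<lambda>j. \<xi> j \<omega>)}"
    by auto
  ultimately show ?thesis by simp
qed

lemma prob_conj_disjoint:
  assumes "finite A" "finite B" "A \<inter> B = {}" "A \<subseteq> {1..}" "B \<subseteq> {1..}"
    and P: "\<And>x y. (\<And>j. j \<in> A \<Longrightarrow> x j = y j) \<Longrightarrow> P x = P y"
    and Q: "\<And>x y. (\<And>j. j \<in> B \<Longrightarrow> x j = y j) \<Longrightarrow> Q x = Q y"
  shows "prob {\<omega> \<in> space M. P (\<lambda>j. \<xi> j \<omega>) \<and> Q (\<lambda>j. \<xi> j \<omega>)} =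
    prob {\<omega> \<in> space M. P (\<lambda>j. \<xi> j \<omega>)} * prob {\<omega> \<in> space M. Q (\<lambda>j. \<xi> j \<omega>)}"
proof -
  let ?r = "\<lambda>A \<omega>. restrict (\<lambda>j. \<xi> j \<omega>) A"
  let ?X = "{x \<in> (\<Pi>\<^sub>E i\<in>A. UNIV). P x}" and ?Y = "{x \<in> (\<Pi>\<^sub>E i\<in>B. UNIV). Q x}"
  have PQ: "P (?r A \<omega>) = P (\<lambda>j. \<xi> j \<omega>)" "Q (?r B \<omega>) = Q (\<lambda>j. \<xi> j \<omega>)" for \<omega>
    by (rule P, simp) (rule Q, simp)
  have X: "?r A -` ?X \<inter> space M = {\<omega> \<in> space M. P (\<lambda>j. \<xi> j \<omega>)}"
    by (auto simp: PQ)
  have Y: "?r B -` ?Y \<inter> space M = {\<omega> \<in> space M. Q (\<lambda>j. \<xi> j \<omega>)}"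
    by (auto simp: PQ)
  have "(\<lambda>\<omega>. (?r A \<omega>, ?r B \<omega>)) -` (?X \<times> ?Y) \<inter> space M =
      (?r A -` ?X \<inter> space M) \<inter> (?r B -` ?Y \<inter> space M)"
    by auto
  also have "\<dots> = {\<omega> \<in> space M. P (\<lambda>j. \<xi> j \<omega>) \<and> Q (\<lambda>j. \<xi> j \<omega>)}"
    unfolding X Y by auto
  finally have XY: "(\<lambda>\<omega>. (?r A \<omega>, ?r B \<omega>)) -` (?X \<times> ?Y) \<inter> space M = \<dots>" .
  have "prob ((\<lambda>\<omega>. (?r A \<omega>, ?r B \<omega>)) -` (?X \<times> ?Y) \<inter> space M) =
      prob (?r A -` ?X \<inter> space M) * prob (?r B -` ?Y \<inter> space M)"
    using indep_var_restrict[OF indep assms(3,4,5)]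
    by (rule indep_varD) (use assms(1,2) in \<open>auto simp: PiM_discrete\<close>)
  then show ?thesis unfolding XY unfolding X Y .
qed

lemma prob_all_ones:
  assumes "finite J" "J \<subseteq> {1..}"
  shows "prob {\<omega> \<in> space M. \<forall>j\<in>J. \<xi> j \<omega> = 1} = (\<Prod>j\<in>J. p j)"
  using assms
proof (induction J rule: finite_induct)
  case empty
  then show ?case by (simp add: prob_space)
next
  case (insert i J)
  have "prob {\<omega> \<in> space M. \<xi> i \<omega> = 1 \<and> (\<forall>j\<in>J. \<xi> j \<omega> = 1)} =
      prob {\<omega> \<in> space M. \<xi> i \<omega> = 1} * prob {\<omega> \<in> space M. \<forall>j\<in>J. \<xi> j \<omega> = 1}"
    using insert.hyps insert.prems
    by (intro prob_conj_disjoint[where A = "{i}" and B = J and P = "\<lambda>x. x i = 1"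
          and Q = "\<lambda>x. \<forall>j\<in>J. x j = 1"]) auto
  then show ?case using insert prob_one[of i] by simp
qed

lemma prob_not:
  assumes "{\<omega> \<in> space M. P \<omega>} \<in> events"
  shows "prob {\<omega> \<in> space M. \<not> P \<omega>} = 1 - prob {\<omega> \<in> space M. P \<omega>}"
proof -
  have "{\<omega> \<in> space M. \<not> P \<omega>} = space M - {\<omega> \<in> space M. P \<omega>}" by auto
  then show ?thesis using prob_compl[OF assms] by simp
qed

lemma prob_zero: "i \<ge> 1 \<Longrightarrow> prob {\<omega> \<in> space M. \<xi> i \<omega> \<noteq> 1} = 1 - p i"
  using prob_not[of "\<lambda>\<omega>. \<xi> i \<omega> = 1"] event_finite[of "{i}" "\<lambda>x. x i = 1"] prob_one[of i]
  by auto

lemma prob_some_zero: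
  assumes "n \<ge> 1"
  shows "prob {\<omega> \<in> space M. \<not> (\<forall>j\<in>{n..n+k}. \<xi> j \<omega> = 1)} = 1 - (\<Prod>j\<in>{n..n+k}. p j)"
proof -
  have "{\<omega> \<in> space M. \<forall>j\<in>{n..n+k}. \<xi> j \<omega> = 1} \<in> events"
    using assms by (intro event_finite[of "{n..n+k}" "\<lambda>x. \<forall>j\<in>{n..n+k}. x j = 1"]) auto
  from prob_not[OF this] show ?thesis
    using assms by (subst (asm) prob_all_ones) auto
qed

lemma prob_zero_then_ones:
  assumes "n \<ge> 1"
  shows "prob {\<omega> \<in> space M. \<xi> n \<omega> \<noteq> 1 \<and> (\<forall>j\<in>{n+1..n+l}. \<xi> j \<omega> = 1)} = w n"
proof -
  have "prob {\<omega> \<in> space M. \<xi> n \<omega> \<noteq> 1 \<and> (\<forall>j\<in>{n+1..n+l}. \<xi> j \<omega> = 1)} =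
      prob {\<omega> \<in> space M. \<xi> n \<omega> \<noteq> 1} * prob {\<omega> \<in> space M. \<forall>j\<in>{n+1..n+l}. \<xi> j \<omega> = 1}"
    using assms
    by (intro prob_conj_disjoint[where A = "{n}" and B = "{n+1..n+l}" and P = "\<lambda>x. x n \<noteq> 1"
          and Q = "\<lambda>x. \<forall>j\<in>{n+1..n+l}. x j = 1"]) auto
  then show ?thesis
    using assms prob_all_ones[of "{n+1..n+l}"] by (simp add: prob_zero w_def del: One_nat_def)
qed

lemma event_no_run: "{\<omega> \<in> space M. no_run n (\<lambda>j. \<xi> j \<omega>)} \<in> events"
proof -
  have "no_run n x = no_run n y" if "\<And>j. j \<in> {1..<n+l} \<Longrightarrow> x j = y j" for x y
    using no_run_cong_past[of "n + l" x y] that by simp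
  then show ?thesis by (rule event_finite[of "{1..<n+l}" "no_run n", rotated 2]) auto
qed

lemma prob_no_run_and_future:
  assumes "n \<ge> 1" and "\<And>x y. (\<And>j. j \<in> {n..n+k} \<Longrightarrow> x j = y j) \<Longrightarrow> Q x = Q y"
  shows "prob {\<omega> \<in> space M. no_run (n - l) (\<lambda>j. \<xi> j \<omega>) \<and> Q (\<lambda>j. \<xi> j \<omega>)} =
    t (n - l) * prob {\<omega> \<in> space M. Q (\<lambda>j. \<xi> j \<omega>)}"
  unfolding run_tail_eq
proof (rule prob_conj_disjoint[where A = "{1..<n}" and B = "{n..n+k}" and P = "no_run (n - l)"
      and Q = Q])
  show "no_run (n - l) x = no_run (n - l) y" if "\<And>j. j \<in> {1..<n} \<Longrightarrow> x j = y j" for x y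
    using that by (rule no_run_cong_past)
  show "Q x = Q y" if "\<And>j. j \<in> {n..n+k} \<Longrightarrow> x j = y j" for x y
    using that by (rule assms(2))
qed (use assms(1) in auto)


subsection \<open>Recursion and one-lag bounds for the tail\<close>

lemma prob_first_run:
  assumes "n \<ge> 1"
  shows "prob {\<omega> \<in> space M. first_run \<xi> l \<omega> = enat (n + 1)} = w n * t (n - l)"
proof -
  let ?Q = "\<lambda>x :: nat \<Rightarrow> nat. x n \<noteq> 1 \<and> (\<forall>j\<in>{n+1..n+l}. x j = 1)"
  have "?Q x = ?Q y" if xy: "\<And>j. j \<in> {n..n+l} \<Longrightarrow> x j = y j" for x y
  proof -
    have "x n = y n" by (intro xy) simp
    moreover have "(\<forall>j\<in>{n+1..n+l}. x j = 1) = (\<forall>j\<in>{n+1..n+l}. y j = 1)"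
      by (intro ball_cong refl) (simp add: xy)
    ultimately show ?thesis by simp
  qed
  from prob_no_run_and_future[of n l ?Q, OF assms this] show ?thesis
    unfolding first_run_eq_iff[OF assms] prob_zero_then_ones[OF assms]
    by (simp only: mult.commute)
qed

lemma tail_0: "t 0 = 1"
  by (simp add: run_tail_eq prob_space)

lemma tail_antimono: "m \<le> n \<Longrightarrow> t n \<le> t m"
  unfolding run_tail_eq
  by (intro finite_measure_mono event_no_run Collect_mono) (blast intro: no_run_mono)

lemma tail_le_1: "t n \<le> 1"
  using tail_antimono[of 0 n] tail_0 by simp

lemma tail_1: "t 1 = 1 - (\<Prod>j\<in>{1..l}. p j)"
  using prob_some_zero[of 1 "l - 1"] l_pos by (simp add: run_tail_eq no_run_Suc)

lemma tail_Suc: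
  assumes "n \<ge> 1"
  shows "t (Suc n) = t n - w n * t (n - l)"
proof -
  have "first_run \<xi> l \<omega> = enat (n + 1) \<longleftrightarrow>
      enat n < first_run \<xi> l \<omega> \<and> \<not> enat (Suc n) < first_run \<xi> l \<omega>" for \<omega>
    by (cases "first_run \<xi> l \<omega>") auto
  then have "{\<omega> \<in> space M. no_run n (\<lambda>j. \<xi> j \<omega>)} - {\<omega> \<in> space M. no_run (Suc n) (\<lambda>j. \<xi> j \<omega>)} =
      {\<omega> \<in> space M. first_run \<xi> l \<omega> = enat (n + 1)}" (is "?A - ?B = ?C")
    unfolding first_run_gt_iff[symmetric] by blast
  then have "prob ?C = prob ?A - prob ?B"
    using finite_measure_Diff[OF event_no_run event_no_run, of "Suc n" n]
    by (simp add: Collect_mono_iff no_run_Suc)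
  then show ?thesis using prob_first_run[OF assms] by (simp add: run_tail_eq)
qed

text \<open>A zero at \<open>n\<close> excludes all runs that start in the last \<open>l\<close> positions up to \<open>n\<close>, and it is
  independent of the event that no run starts up to \<open>n - l\<close>.\<close>

lemma tail_ge:
  assumes "n \<ge> 1"
  shows "(1 - p n) * t (n - l) \<le> t n"
proof -
  have "(1 - p n) * t (n - l) =
      prob {\<omega> \<in> space M. no_run (n - l) (\<lambda>j. \<xi> j \<omega>) \<and> \<xi> n \<omega> \<noteq> 1}"
    using prob_no_run_and_future[of n 0 "\<lambda>x. x n \<noteq> 1"] assms
    unfolding prob_zero[OF assms] by simp
  also have "\<dots> \<le> t n"
    unfolding run_tail_eq
    by (intro finite_measure_mono event_no_run Collect_mono) (blast intro: no_run_if_zero)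
  finally show ?thesis .
qed

text \<open>Among the last \<open>l\<close> starting points only \<open>n\<close> itself is taken into account; whether a run
  starts there is independent of the event that none starts up to \<open>n - l\<close>.\<close>

lemma tail_le:
  assumes "n \<ge> 1"
  shows "t n \<le> t (n - l) * (1 - (\<Prod>j\<in>{n..n+l-1}. p j))"
proof -
  obtain k where k: "l = Suc k" using l_pos by (cases l) auto
  have "t n \<le> prob {\<omega> \<in> space M. no_run (n - l) (\<lambda>j. \<xi> j \<omega>) \<and> \<not> (\<forall>j\<in>{n..n+k}. \<xi> j \<omega> = 1)}"
    unfolding run_tail_eq
  proof (rule finite_measure_mono)
    show "{\<omega> \<in> space M. no_run (n - l) (\<lambda>j. \<xi> j \<omega>) \<and> \<not> (\<forall>j\<in>{n..n+k}. \<xi> j \<omega> = 1)} \<in> events"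
    proof (rule event_finite[of "{1..n+k}" "\<lambda>x. no_run (n - l) x \<and> \<not> (\<forall>j\<in>{n..n+k}. x j = 1)"])
      fix x y :: "nat \<Rightarrow> nat" assume xy: "\<And>j. j \<in> {1..n+k} \<Longrightarrow> x j = y j"
      have "no_run (n - l) x = no_run (n - l) y"
        by (rule no_run_cong_past) (simp add: xy)
      moreover have "(\<forall>j\<in>{n..n+k}. x j = 1) = (\<forall>j\<in>{n..n+k}. y j = 1)"
        using assms by (intro ball_cong refl) (simp add: xy)
      ultimately show "(no_run (n - l) x \<and> \<not> (\<forall>j\<in>{n..n+k}. x j = 1)) =
          (no_run (n - l) y \<and> \<not> (\<forall>j\<in>{n..n+k}. y j = 1))"
        by simp
    qed auto
    show "{\<omega> \<in> space M. no_run n (\<lambda>j. \<xi> j \<omega>)} \<subseteq>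
        {\<omega> \<in> space M. no_run (n - l) (\<lambda>j. \<xi> j \<omega>) \<and> \<not> (\<forall>j\<in>{n..n+k}. \<xi> j \<omega> = 1)}"
    proof
      fix \<omega> assume "\<omega> \<in> {\<omega> \<in> space M. no_run n (\<lambda>j. \<xi> j \<omega>)}"
      then have *: "\<omega> \<in> space M" "no_run n (\<lambda>j. \<xi> j \<omega>)" by simp_all
      then show "\<omega> \<in> {\<omega> \<in> space M. no_run (n - l) (\<lambda>j. \<xi> j \<omega>) \<and> \<not> (\<forall>j\<in>{n..n+k}. \<xi> j \<omega> = 1)}"
        using no_run_mono[OF _ *(2), of "n - l"] no_run_ex_zero[OF *(2) assms] k by simp
    qed
  qed
  also have "\<dots> = t (n - l) * (1 - (\<Prod>j\<in>{n..n+k}. p j))"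
  proof -
    let ?Q = "\<lambda>x :: nat \<Rightarrow> nat. \<not> (\<forall>j\<in>{n..n+k}. x j = 1)"
    have "?Q x = ?Q y" if "\<And>j. j \<in> {n..n+k} \<Longrightarrow> x j = y j" for x y
      using that by (intro arg_cong[where f = Not] ball_cong refl) simp
    from prob_no_run_and_future[of n k ?Q, OF assms this] show ?thesis
      unfolding prob_some_zero[OF assms] .
  qed
  finally show ?thesis using k by simp
qed

lemma tail_pos: "0 < t n"
proof (induction n rule: less_induct)
  case (less n)
  show ?case
  proof (cases n)
    case 0
    then show ?thesis by (simp add: tail_0)
  next
    case (Suc m)
    then have "0 < (1 - p n) * t (n - l)"
      using less[of "n - l"] l_pos p_less_1[of n] by auto
    also have "\<dots> \<le> t n" using Suc by (intro tail_ge) auto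
    finally show ?thesis .
  qed
qed


section \<open>Almost sure finiteness and the series criterion\<close>

lemma w_pos: "n \<ge> 1 \<Longrightarrow> 0 < w n"
  unfolding w_def by (intro mult_pos_pos prod_pos) (simp_all add: p_pos p_less_1)

lemma run_series_eq: "run_series p l = (\<Sum>n. ennreal (w (Suc n)))"
  unfolding run_series_def Let_def w_def ..

lemma run_series_infinite_iff: "run_series p l = \<infinity> \<longleftrightarrow> \<not> summable (\<lambda>n. w (Suc n))"
proof -
  have nonneg: "0 \<le> w (Suc n)" for n using w_pos[of "Suc n"] by simp
  have "summable (\<lambda>n. w (Suc n)) \<Longrightarrow> run_series p l \<noteq> \<infinity>"
    unfolding run_series_eq infinity_ennreal_def by (intro ennreal_suminf_neq_top nonneg)
  moreover have "run_series p l \<noteq> \<infinity> \<Longrightarrow> summable (\<lambda>n. w (Suc n))"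
    unfolding run_series_eq infinity_ennreal_def by (intro summable_suminf_not_top nonneg)
  ultimately show ?thesis by blast
qed

lemma first_run_infinite_iff: "first_run \<xi> l \<omega> = \<infinity> \<longleftrightarrow> (\<forall>n. no_run n (\<lambda>j. \<xi> j \<omega>))"
  unfolding first_run_gt_iff[symmetric] by (cases "first_run \<xi> l \<omega>") auto

lemma infinite_eq_INT:
  "{\<omega> \<in> space M. first_run \<xi> l \<omega> = \<infinity>} = (\<Inter>n. {\<omega> \<in> space M. no_run n (\<lambda>j. \<xi> j \<omega>)})"
  unfolding first_run_infinite_iff by blast

lemma prob_infinite_lim: "t \<longlonglongrightarrow> prob {\<omega> \<in> space M. first_run \<xi> l \<omega> = \<infinity>}"
  unfolding infinite_eq_INT run_tail_eq
proof (rule finite_Lim_measure_decseq)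
  show "range (\<lambda>n. {\<omega> \<in> space M. no_run n (\<lambda>j. \<xi> j \<omega>)}) \<subseteq> events"
    using event_no_run by (rule image_subsetI)
  show "decseq (\<lambda>n. {\<omega> \<in> space M. no_run n (\<lambda>j. \<xi> j \<omega>)})"
    unfolding decseq_Suc_iff no_run_Suc by (intro allI Collect_mono) simp
qed

lemma AE_finite_if_tail_tendsto_0:
  assumes "t \<longlonglongrightarrow> 0"
  shows "AE \<omega> in M. first_run \<xi> l \<omega> < \<infinity>"
proof -
  have ev: "{\<omega> \<in> space M. first_run \<xi> l \<omega> = \<infinity>} \<in> events"
    unfolding infinite_eq_INT by (intro sets.countable_INT image_subsetI event_no_run) simp
  have "prob {\<omega> \<in> space M. first_run \<xi> l \<omega> = \<infinity>} = 0"
    using LIMSEQ_unique[OF prob_infinite_lim assms] .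
  then have "emeasure M {\<omega> \<in> space M. first_run \<xi> l \<omega> = \<infinity>} = 0"
    by (simp add: emeasure_eq_measure)
  then have "AE \<omega> in M. \<not> first_run \<xi> l \<omega> = \<infinity>"
    by (subst AE_iff_measurable[OF ev]) simp_all
  then show ?thesis by simp
qed

lemma tail_telescope: "(\<Sum>k<n. w (Suc m + k) * t (Suc m + k - l)) = t (Suc m) - t (Suc m + n)"
proof (induction n)
  case (Suc n)
  then show ?case using tail_Suc[of "Suc m + n"] by simp
qed simp

text \<open>If \<open>t\<close> decreased to a limit \<open>c > 0\<close>, each drop \<open>w n * t (n - l)\<close> would be at least
  \<open>c * w n\<close>, while all drops together amount to at most \<open>1\<close>.\<close>

lemma tail_tendsto_0_if_series_infinite:
  assumes "\<not> summable (\<lambda>n. w (Suc n))"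
  shows "t \<longlonglongrightarrow> 0"
proof -
  define c where "c = prob {\<omega> \<in> space M. first_run \<xi> l \<omega> = \<infinity>}"
  have c: "c \<ge> 0" "t \<longlonglongrightarrow> c" using prob_infinite_lim by (auto simp: c_def)
  have c_le: "c \<le> t n" for n
    by (rule decseq_ge[OF _ c(2)]) (simp add: decseq_def tail_antimono)
  have "c = 0"
  proof (rule ccontr)
    assume "c \<noteq> 0"
    then have "c > 0" using c by simp
    have bound: "(\<Sum>k<n. w (Suc k)) \<le> 1 / c" for n
    proof -
      have "(\<Sum>k<n. w (Suc k)) * c \<le> (\<Sum>k<n. w (Suc 0 + k) * t (Suc 0 + k - l))"
        unfolding sum_distrib_right using w_pos c_le
        by (intro sum_mono) (auto intro!: mult_left_mono less_imp_le)
      also have "\<dots> \<le> 1"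
        unfolding tail_telescope using tail_le_1[of 1] tail_pos[of "Suc 0 + n"] by simp
      finally show ?thesis using \<open>c > 0\<close> by (simp add: field_simps)
    qed
    have "summable (\<lambda>k. w (Suc k))"
    proof (rule bounded_imp_summable)
      show "(\<Sum>k\<le>n. w (Suc k)) \<le> 1 / c" for n
        unfolding lessThan_Suc_atMost[symmetric] by (rule bound)
    qed (use w_pos in \<open>simp add: less_imp_le\<close>)
    with assms show False ..
  qed
  then show ?thesis using c by simp
qed

lemma window_prod_tendsto_1:
  assumes "p \<longlonglongrightarrow> 1"
  shows "(\<lambda>n. \<Prod>j\<in>{n+a..n+b}. p j) \<longlonglongrightarrow> 1"
proof -
  have "(\<lambda>n. \<Prod>i\<in>{a..b}. p (n + i)) \<longlonglongrightarrow> (\<Prod>i\<in>{a..b}. 1)"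
    by (intro tendsto_prod LIMSEQ_ignore_initial_segment assms)
  moreover have "(\<Prod>j\<in>{n+a..n+b}. p j) = (\<Prod>i\<in>{a..b}. p (n + i))" for n
    using prod.shift_bounds_cl_nat_ivl[of p a n b] by (simp add: add.commute)
  ultimately show ?thesis by simp
qed

text \<open>As \<open>p\<close> tends to \<open>1\<close>, a run starts at position \<open>n\<close> with probability tending to \<open>1\<close>.\<close>

lemma tail_tendsto_0_if_summable:
  assumes "summable (\<lambda>i. 1 - p (Suc i))"
  shows "t \<longlonglongrightarrow> 0"
proof -
  have "(\<lambda>i. 1 - (1 - p (Suc i))) \<longlonglongrightarrow> 1 - 0"
    by (intro tendsto_intros summable_LIMSEQ_zero assms)
  then have "p \<longlonglongrightarrow> 1" by (simp add: filterlim_sequentially_Suc)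
  then have "(\<lambda>n. 1 - (\<Prod>j\<in>{n+0..n+(l-1)}. p j)) \<longlonglongrightarrow> 1 - 1"
    by (intro tendsto_diff tendsto_const window_prod_tendsto_1)
  then have lim: "(\<lambda>n. 1 - (\<Prod>j\<in>{n..n+l-1}. p j)) \<longlonglongrightarrow> 0" using l_pos by simp
  have "t n \<le> 1 - (\<Prod>j\<in>{n..n+l-1}. p j)" if "n \<ge> 1" for n
  proof -
    have "(\<Prod>j\<in>{n..n+l-1}. p j) \<le> 1"
      using p_pos p_less_1 that by (intro prod_le_1) (auto intro: less_imp_le)
    then have "t (n - l) * (1 - (\<Prod>j\<in>{n..n+l-1}. p j)) \<le> 1 * (1 - (\<Prod>j\<in>{n..n+l-1}. p j))"
      by (intro mult_right_mono tail_le_1) auto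
    with tail_le[OF that] show ?thesis by simp
  qed
  then have "eventually (\<lambda>n. t n \<le> 1 - (\<Prod>j\<in>{n..n+l-1}. p j)) sequentially"
    by (auto simp: eventually_sequentially)
  moreover have "eventually (\<lambda>n. 0 \<le> t n) sequentially"
    by (intro always_eventually allI less_imp_le tail_pos)
  ultimately show ?thesis
    by (rule tendsto_sandwich[OF _ _ tendsto_const lim, rotated])
qed

text \<open>The product in \<open>w n\<close> tends to \<open>1\<close>, so \<open>w n\<close> and \<open>1 - p n\<close> are asymptotically equal.\<close>

lemma summable_compl_if_tendsto_1:
  assumes "summable (\<lambda>n. w (Suc n))" "p \<longlonglongrightarrow> 1"
  shows "summable (\<lambda>i. 1 - p (Suc i))"
proof (rule summable_comparison_test_ev)
  show "summable (\<lambda>i. 2 * w (Suc i))" using assms(1) by (rule summable_mult)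
  have "(\<lambda>n. \<Prod>j\<in>{n+1..n+l}. p j) \<longlonglongrightarrow> 1" using assms(2) by (rule window_prod_tendsto_1)
  then have "eventually (\<lambda>n. (\<Prod>j\<in>{n+1..n+l}. p j) > 1 / 2) sequentially"
    by (rule order_tendstoD) simp
  then have "eventually (\<lambda>n. (\<Prod>j\<in>{Suc n+1..Suc n+l}. p j) > 1 / 2) sequentially"
    by (subst (asm) eventually_sequentially_Suc[symmetric]) simp
  then show "eventually (\<lambda>i. norm (1 - p (Suc i)) \<le> 2 * w (Suc i)) sequentially"
  proof eventually_elim
    case (elim i)
    have "(1 - p (Suc i)) * (1 / 2) \<le> w (Suc i)"
      unfolding w_def using elim p_less_1[of "Suc i"] by (intro mult_left_mono) auto
    then show ?case using p_less_1[of "Suc i"] by simp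
  qed
qed

text \<open>If the tail vanished, summing the recursion from \<open>n\<close> onwards would bound \<open>t n\<close> by
  \<open>t (n - l)\<close> times the remainder of the series of \<open>w\<close>. Since \<open>t n\<close> is at least
  \<open>(1 - p n) * t (n - l)\<close>, this forces \<open>p\<close> to tend to \<open>1\<close>, in which case the two series
  converge together.\<close>

lemma tail_limit_pos:
  assumes "\<not> summable (\<lambda>i. 1 - p (Suc i))" "summable (\<lambda>n. w (Suc n))"
  shows "0 < prob {\<omega> \<in> space M. first_run \<xi> l \<omega> = \<infinity>}"
proof (rule ccontr)
  assume "\<not> ?thesis"
  then have "prob {\<omega> \<in> space M. first_run \<xi> l \<omega> = \<infinity>} = 0"
    using measure_nonneg[of M "{\<omega> \<in> space M. first_run \<xi> l \<omega> = \<infinity>}"] by linarith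
  then have t0: "t \<longlonglongrightarrow> 0" using prob_infinite_lim by simp
  define R where "R n = (\<Sum>k. w (Suc (k + n)))" for n
  have sm: "summable (\<lambda>k. w (Suc (k + n)))" for n
    using summable_ignore_initial_segment[OF assms(2), of n] by simp
  have "(\<lambda>n. (\<Sum>k. w (Suc k)) - (\<Sum>k<n. w (Suc k))) \<longlonglongrightarrow> (\<Sum>k. w (Suc k)) - (\<Sum>k. w (Suc k))"
    by (intro tendsto_intros summable_LIMSEQ assms(2))
  then have R_lim: "R \<longlonglongrightarrow> 0"
    unfolding R_def using suminf_minus_initial_segment[OF assms(2)] by simp
  have q_le: "1 - p (Suc n) \<le> R n" for n
  proof -
    have "t (Suc n) - t (Suc n + k) \<le> R n * t (Suc n - l)" for k
    proof -
      have "t (Suc n) - t (Suc n + k) = (\<Sum>i<k. w (Suc n + i) * t (Suc n + i - l))"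
        by (rule tail_telescope[symmetric])
      also have "\<dots> \<le> (\<Sum>i<k. w (Suc n + i) * t (Suc n - l))"
        using w_pos by (intro sum_mono mult_left_mono tail_antimono) (auto intro: less_imp_le)
      also have "\<dots> = (\<Sum>i<k. w (Suc (i + n))) * t (Suc n - l)"
        by (simp add: sum_distrib_right add.commute)
      also have "\<dots> \<le> R n * t (Suc n - l)"
        unfolding R_def using w_pos tail_pos
        by (intro mult_right_mono sum_le_suminf sm) (auto intro: less_imp_le)
      finally show ?thesis .
    qed
    moreover have lim: "(\<lambda>k. t (Suc n) - t (Suc n + k)) \<longlonglongrightarrow> t (Suc n) - 0"
      using LIMSEQ_ignore_initial_segment[OF t0, of "Suc n"]
      by (intro tendsto_intros) (simp add: add.commute)
    ultimately have "t (Suc n) - 0 \<le> R n * t (Suc n - l)"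
      by (intro LIMSEQ_le_const2[OF lim]) blast
    then have "(1 - p (Suc n)) * t (Suc n - l) \<le> R n * t (Suc n - l)"
      using tail_ge[of "Suc n"] by linarith
    then show ?thesis using tail_pos[of "Suc n - l"] by (simp only: mult_le_cancel_right_pos)
  qed
  have "(\<lambda>n. 1 - p (Suc n)) \<longlonglongrightarrow> 0"
  proof (rule tendsto_sandwich[OF _ _ tendsto_const R_lim])
    show "\<forall>\<^sub>F n in sequentially. 0 \<le> 1 - p (Suc n)"
      using p_less_1 by (intro always_eventually allI) (simp add: less_imp_le)
  qed (use q_le in simp)
  then have "(\<lambda>n. 1 - (1 - p (Suc n))) \<longlonglongrightarrow> 1 - 0" by (intro tendsto_intros)
  then have "p \<longlonglongrightarrow> 1" by (simp add: filterlim_sequentially_Suc)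
  with assms summable_compl_if_tendsto_1 show False by blast
qed


subsection \<open>Growth conditions on the parameters\<close>

text \<open>If \<open>p\<close> tends to \<open>1\<close>, both series diverge together. Otherwise \<open>1 - p n \<ge> \<delta>\<close>
  for infinitely many \<open>n\<close>, and the terms \<open>w n\<close> of a convergent series can be small at such \<open>n\<close>
  only if another such index follows within distance \<open>l\<close>. These indices thus meet every window of
  length \<open>l\<close>, and each of them contributes at least a constant times \<open>n powr (- c l)\<close>, where
  \<open>c l < 1\<close>.\<close>

lemma series_infinite_if_slow_decay:
  assumes lim: "limsup (\<lambda>i. ereal (- ln (p i) / ln (real i))) < ereal (1 / real l)"
    and nsum: "\<not> summable (\<lambda>i. 1 - p (Suc i))"
  shows "\<not> summable (\<lambda>n. w (Suc n))"
proof
  assume sum: "summable (\<lambda>n. w (Suc n))"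
  obtain c where c: "limsup (\<lambda>i. ereal (- ln (p i) / ln (real i))) < ereal c" "c < 1 / real l"
    using ereal_dense2[OF lim] by auto
  have "eventually (\<lambda>i. ereal (- ln (p i) / ln (real i)) < ereal c) sequentially"
    using c(1) by (rule Limsup_lessD)
  then have "eventually (\<lambda>i. - ln (p i) / ln (real i) < c) sequentially" by simp
  then obtain N0 where N0: "\<And>i. i \<ge> N0 \<Longrightarrow> - ln (p i) / ln (real i) < c"
    by (auto simp: eventually_sequentially)
  define N1 where "N1 = max 2 N0"
  have p_ge: "p i \<ge> real i powr (- c)" if "i \<ge> N1" for i
  proof -
    have "- ln (p i) < c * ln (real i)"
      using N0[of i] that by (simp add: N1_def field_simps)
    then have "exp (- (c * ln (real i))) \<le> exp (ln (p i))" by simp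
    also have "exp (ln (p i)) = p i" using p_pos[of i] that by (simp add: N1_def)
    finally show ?thesis using that by (simp add: N1_def powr_def)
  qed
  have "N1 \<ge> 1" by (simp add: N1_def)
  then have "0 \<le> - ln (p N1) / ln (real N1)"
    using p_pos[of N1] p_less_1[of N1] by (intro divide_nonneg_nonneg) simp_all
  then have c_pos: "c > 0" using N0[of N1] by (simp add: N1_def)
  have "\<not> p \<longlonglongrightarrow> 1" using summable_compl_if_tendsto_1[OF sum] nsum by blast
  then obtain \<delta>0 where \<delta>0: "\<delta>0 > 0" "\<And>n0. \<exists>n\<ge>n0. \<bar>p n - 1\<bar> \<ge> \<delta>0"
    unfolding lim_sequentially dist_real_def by (metis not_less)
  \<comment> \<open>The minimum with \<open>1 / 2\<close> keeps the threshold \<open>\<delta> * (1 - \<delta>) ^ l\<close> below positive.\<close>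
  define \<delta> where "\<delta> = min \<delta>0 (1 / 2)"
  have \<delta>: "0 < \<delta>" "\<delta> < 1" using \<delta>0 by (auto simp: \<delta>_def)
  have frequent: "\<exists>n\<ge>n0. \<delta> \<le> 1 - p n" for n0
  proof -
    obtain n where "n \<ge> max 1 n0" "\<bar>p n - 1\<bar> \<ge> \<delta>0" using \<delta>0(2) by blast
    then show ?thesis using p_less_1[of n] by (intro exI[of _ n]) (auto simp: \<delta>_def)
  qed
  have "w \<longlonglongrightarrow> 0"
    using summable_LIMSEQ_zero[OF sum] by (simp add: filterlim_sequentially_Suc)
  then have "eventually (\<lambda>n. w n < \<delta> * (1 - \<delta>) ^ l) sequentially"
    using \<delta> by (intro order_tendstoD) auto
  then obtain N2 where N2: "\<And>n. n \<ge> N2 \<Longrightarrow> w n < \<delta> * (1 - \<delta>) ^ l"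
    by (auto simp: eventually_sequentially)
  have follow: "\<exists>j\<in>{n+1..n+l}. \<delta> \<le> 1 - p j" if n: "n \<ge> max 1 N2" "\<delta> \<le> 1 - p n" for n
  proof (rule ccontr)
    assume "\<not> ?thesis"
    then have "1 - \<delta> \<le> p j" if "j \<in> {n+1..n+l}" for j using that by force
    then have "(\<Prod>j\<in>{n+1..n+l}. 1 - \<delta>) \<le> (\<Prod>j\<in>{n+1..n+l}. p j)"
      using \<delta> by (intro prod_mono) auto
    then have "\<delta> * (1 - \<delta>) ^ l \<le> w n"
      unfolding w_def using n \<delta> by (intro mult_mono) auto
    with N2[of n] n show False by simp
  qed
  obtain n0 where n0: "n0 \<ge> max N1 N2" "\<delta> \<le> 1 - p n0" using frequent by blast
  have n0_ge: "n0 \<ge> 2" "n0 \<ge> N1" "n0 \<ge> N2" using n0 by (auto simp: N1_def)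
  have every_window: "\<exists>j\<in>{i+1..i+l}. \<delta> \<le> 1 - p j" if "i \<ge> n0" for i
    using that
  proof (induction i rule: dec_induct)
    case base
    show ?case using follow[of n0] n0 n0_ge by simp
  next
    case (step i)
    then obtain j where j: "j \<in> {i+1..i+l}" "\<delta> \<le> 1 - p j" by blast
    show ?case
    proof (cases "j = i + 1")
      case True
      then show ?thesis using follow[of j] j step n0_ge by simp
    next
      case False
      then show ?thesis using j by (intro bexI[of _ j]) auto
    qed
  qed
  have window_ge: "\<delta> * real (i + 2 * l) powr (- c * real l) \<le> (\<Sum>j\<in>{i+1..i+l}. w j)"
    if i: "i \<ge> n0" for i
  proof -
    obtain j where j: "j \<in> {i+1..i+l}" "\<delta> \<le> 1 - p j" using every_window[OF i] by blast
    have "real (i + 2 * l) powr (- c * real l) = (\<Prod>m\<in>{j+1..j+l}. real (i + 2 * l) powr (- c))"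
      using l_pos by (simp add: powr_powr flip: powr_realpow)
    also have "\<dots> \<le> (\<Prod>m\<in>{j+1..j+l}. p m)"
    proof (rule prod_mono)
      fix m assume m: "m \<in> {j+1..j+l}"
      have "real (i + 2 * l) powr (- c) \<le> real m powr (- c)"
        using m j i n0_ge c_pos by (intro powr_mono2') auto
      also have "\<dots> \<le> p m" using m j i n0_ge by (intro p_ge) auto
      finally show "0 \<le> real (i + 2 * l) powr (- c) \<and> real (i + 2 * l) powr (- c) \<le> p m" by simp
    qed
    finally have "\<delta> * real (i + 2 * l) powr (- c * real l) \<le> w j"
      unfolding w_def using j \<delta> by (intro mult_mono) auto
    also have "\<dots> \<le> (\<Sum>j\<in>{i+1..i+l}. w j)"
      using j w_pos by (intro member_le_sum) (auto intro: less_imp_le)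
    finally show ?thesis .
  qed
  have "summable (\<lambda>i. \<Sum>m\<in>{1..l}. w (i + m))"
  proof (rule summable_sum)
    fix m assume "m \<in> {1..l}"
    then show "summable (\<lambda>i. w (i + m))"
      using summable_ignore_initial_segment[OF sum, of "m - 1"] by simp
  qed
  moreover have "(\<Sum>m\<in>{1..l}. w (i + m)) = (\<Sum>j\<in>{i+1..i+l}. w j)" for i
    using sum.shift_bounds_cl_nat_ivl[of w 1 i l] by (simp add: add.commute)
  ultimately have "summable (\<lambda>i. \<Sum>j\<in>{i+1..i+l}. w j)" by simp
  then have "summable (\<lambda>i. \<delta> * real (i + 2 * l) powr (- c * real l))"
  proof (rule summable_comparison_test_ev[rotated])
    show "\<forall>\<^sub>F i in sequentially. norm (\<delta> * real (i + 2 * l) powr (- c * real l)) \<le>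
        (\<Sum>j\<in>{i+1..i+l}. w j)"
      using window_ge \<delta> by (intro eventually_sequentiallyI[of n0]) (simp add: abs_mult)
  qed
  then have "summable (\<lambda>i. real i powr (- c * real l))"
    using \<delta> summable_iff_shift[of "\<lambda>i. real i powr (- c * real l)" "2 * l"]
    by (simp add: summable_cmult_iff)
  then have "- c * real l < -1" by (simp add: summable_real_powr_iff)
  with c(2) l_pos show False by (simp add: field_simps)
qed

lemma series_finite_if_fast_decay:
  assumes lim: "ereal (1 / real l) < liminf (\<lambda>i. ereal (- ln (p i) / ln (real i)))"
  shows "summable (\<lambda>n. w (Suc n))"
proof -
  obtain c where c: "1 / real l < c" "ereal c < liminf (\<lambda>i. ereal (- ln (p i) / ln (real i)))"
    using ereal_dense2[OF lim] by auto
  have c_pos: "c > 0" using c(1) by (rule le_less_trans[rotated]) simp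
  have "eventually (\<lambda>i. ereal c < ereal (- ln (p i) / ln (real i))) sequentially"
    using c(2) by (rule less_LiminfD)
  then have "eventually (\<lambda>i. c < - ln (p i) / ln (real i)) sequentially" by simp
  then obtain N0 where N0: "\<And>i. i \<ge> N0 \<Longrightarrow> c < - ln (p i) / ln (real i)"
    by (auto simp: eventually_sequentially)
  define N1 where "N1 = max 2 N0"
  have p_le: "p i \<le> real i powr (- c)" if "i \<ge> N1" for i
  proof -
    have "c * ln (real i) < - ln (p i)"
      using N0[of i] that by (simp add: N1_def field_simps)
    then have "exp (ln (p i)) \<le> exp (- (c * ln (real i)))" by simp
    also have "exp (ln (p i)) = p i" using p_pos[of i] that by (simp add: N1_def)
    finally show ?thesis using that by (simp add: N1_def powr_def)
  qed
  have w_le: "w n \<le> real n powr (- c * real l)" if n: "n \<ge> N1" for n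
  proof -
    have n1: "n \<ge> 1" using n by (simp add: N1_def)
    have "w n \<le> 1 * (\<Prod>j\<in>{n+1..n+l}. p j)"
      unfolding w_def using p_pos n1
      by (intro mult_right_mono prod_nonneg) (auto intro: less_imp_le)
    also have "\<dots> \<le> (\<Prod>j\<in>{n+1..n+l}. real n powr (- c))"
      unfolding mult_1
    proof (rule prod_mono)
      fix j assume j: "j \<in> {n+1..n+l}"
      have "p j \<le> real j powr (- c)" using j n by (intro p_le) auto
      also have "\<dots> \<le> real n powr (- c)" using j n1 c_pos by (intro powr_mono2') auto
      finally show "0 \<le> p j \<and> p j \<le> real n powr (- c)" using p_pos[of j] j by simp
    qed
    also have "\<dots> = real n powr (- c * real l)"
      using n1 by (simp add: powr_powr flip: powr_realpow)
    finally show ?thesis .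
  qed
  have "- c * real l < -1" using c(1) l_pos by (simp add: field_simps)
  then have "summable (\<lambda>n. real n powr (- c * real l))" by (simp add: summable_real_powr_iff)
  then have "summable w"
  proof (rule summable_comparison_test_ev[rotated])
    show "\<forall>\<^sub>F n in sequentially. norm (w n) \<le> real n powr (- c * real l)"
      using w_le w_pos by (intro eventually_sequentiallyI[of N1]) (auto simp: N1_def less_imp_le)
  qed
  then show ?thesis by (simp add: summable_Suc_iff)
qed


section \<open>Short and long tails\<close>

lemma lag_ge: "(1 - p (n + l)) * t n \<le> t (n + l)"
  using tail_ge[of "n + l"] l_pos by simp

lemma lag_le: "t (n + l) \<le> t n * (1 - (\<Prod>j\<in>{n+l..n+(2*l-1)}. p j))"
proof -
  have "n + l + l - 1 = n + (2 * l - 1)" using l_pos by simp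
  then show ?thesis using tail_le[of "n + l"] l_pos by simp
qed

lemma short_tail:
  assumes "p \<longlonglongrightarrow> 1" "n \<ge> l"
  shows "(\<lambda>i. t (i + n) / t i) \<longlonglongrightarrow> 0"
proof -
  have "(\<lambda>i. 1 - (\<Prod>j\<in>{i+l..i+(2*l-1)}. p j)) \<longlonglongrightarrow> 1 - 1"
    by (intro tendsto_diff tendsto_const window_prod_tendsto_1 assms)
  then have lim: "(\<lambda>i. 1 - (\<Prod>j\<in>{i+l..i+(2*l-1)}. p j)) \<longlonglongrightarrow> 0" by simp
  show ?thesis
  proof (rule tendsto_sandwich[OF _ _ tendsto_const lim])
    have "t (i + n) / t i \<le> 1 - (\<Prod>j\<in>{i+l..i+(2*l-1)}. p j)" for i
    proof -
      have "t (i + n) \<le> t (i + l)" using assms(2) by (intro tail_antimono) simp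
      also note lag_le[of i]
      finally show ?thesis using tail_pos[of i] by (simp add: field_simps)
    qed
    then show "\<forall>\<^sub>F i in sequentially. t (i + n) / t i \<le> 1 - (\<Prod>j\<in>{i+l..i+(2*l-1)}. p j)"
      by simp
    have "0 \<le> t (i + n) / t i" for i using tail_pos by (simp add: less_imp_le)
    then show "\<forall>\<^sub>F i in sequentially. 0 \<le> t (i + n) / t i" by simp
  qed
qed

lemma long_tail:
  assumes "p \<longlonglongrightarrow> 0"
  shows "(\<lambda>i. t (i + n) / t i) \<longlonglongrightarrow> 1"
proof -
  have ratio_le_1: "t (i + k) / t i \<le> 1" for i k
    using tail_pos[of i] tail_antimono[of i "i + k"] by simp
  have lag: "(\<lambda>i. t (i + l) / t i) \<longlonglongrightarrow> 1"
  proof (rule tendsto_sandwich)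
    have "1 - p (i + l) \<le> t (i + l) / t i" for i
      using lag_ge[of i] tail_pos[of i] by (simp add: field_simps)
    then show "\<forall>\<^sub>F i in sequentially. 1 - p (i + l) \<le> t (i + l) / t i" by simp
    show "\<forall>\<^sub>F i in sequentially. t (i + l) / t i \<le> 1" using ratio_le_1 by simp
    have "(\<lambda>i. 1 - p (i + l)) \<longlonglongrightarrow> 1 - 0"
      by (intro tendsto_diff tendsto_const LIMSEQ_ignore_initial_segment assms)
    then show "(\<lambda>i. 1 - p (i + l)) \<longlonglongrightarrow> 1" by simp
  qed (rule tendsto_const)
  have multiple: "(\<lambda>i. t (i + k * l) / t i) \<longlonglongrightarrow> 1" for k
  proof (induction k)
    case 0
    have "t i / t i = 1" for i using tail_pos[of i] by simp
    then show ?case by simp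
  next
    case (Suc k)
    have "(\<lambda>i. t (i + k * l + l) / t (i + k * l) * (t (i + k * l) / t i)) \<longlonglongrightarrow> 1 * 1"
      by (intro tendsto_mult Suc LIMSEQ_ignore_initial_segment[OF lag])
    moreover have "t (i + k * l + l) / t (i + k * l) * (t (i + k * l) / t i) = t (i + Suc k * l) / t i"
      for i
      using tail_pos[of "i + k * l"] by (simp add: ac_simps)
    ultimately show ?case by (simp only: mult_1)
  qed
  show ?thesis
  proof (rule tendsto_sandwich[OF _ _ multiple[of n] tendsto_const])
    have "t (i + n * l) / t i \<le> t (i + n) / t i" for i
      using tail_pos[of i] l_pos by (intro divide_right_mono tail_antimono) auto
    then show "\<forall>\<^sub>F i in sequentially. t (i + n * l) / t i \<le> t (i + n) / t i" by simp
  qed (use ratio_le_1 in simp)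
qed

section \<open>The homogeneous case\<close>

text \<open>Conditioning on the position of the first zero gives this renewal equation. It also follows
  from the recursion for the tail: the difference of the two sides is multiplied by \<open>r\<close> when \<open>n\<close>
  increases by one, and it vanishes at \<open>n = 1\<close>.\<close>

lemma homogeneous_renewal:
  assumes p: "\<And>i. i \<ge> 1 \<Longrightarrow> p i = r" and n: "n \<ge> 1"
  shows "t n = (1 - r) * (\<Sum>i<l. r ^ i * t (n - Suc i))"
  using n
proof (induction n rule: dec_induct)
  case base
  have "(1 - r) * (\<Sum>i<l. r ^ i) = 1 - r ^ l" by (rule one_diff_power_eq[symmetric])
  then show ?case using p by (simp add: tail_0 tail_1[simplified])
next
  case (step n)
  have w: "w n = (1 - r) * r ^ l" using p step unfolding w_def by simp
  have "(\<Sum>i<l. r ^ i * t (n - i)) + r ^ l * t (n - l) = (\<Sum>i<Suc l. r ^ i * t (n - i))"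
    by simp
  also have "\<dots> = t n + r * (\<Sum>i<l. r ^ i * t (n - Suc i))"
    unfolding sum.lessThan_Suc_shift by (simp add: sum_distrib_left mult.assoc)
  finally have shift: "(\<Sum>i<l. r ^ i * t (n - i)) =
      t n + r * (\<Sum>i<l. r ^ i * t (n - Suc i)) - r ^ l * t (n - l)"
    by linarith
  have "(1 - r) * (\<Sum>i<l. r ^ i * t (n - i)) =
      (1 - r) * t n + r * ((1 - r) * (\<Sum>i<l. r ^ i * t (n - Suc i))) - w n * t (n - l)"
    unfolding shift w by (simp add: algebra_simps)
  also have "\<dots> = t n - w n * t (n - l)"
    unfolding step.IH[symmetric] by (simp add: algebra_simps)
  also have "\<dots> = t (Suc n)" using step by (intro tail_Suc[symmetric]) simp
  finally show ?case by simp
qed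

lemma characteristic_root_exists:
  fixes r :: real
  assumes "0 < r" "r < 1"
  shows "\<exists>z>0. (1 - r) * z * (\<Sum>i<l. (r * z) ^ i) = 1"
proof -
  define f where "f z = (1 - r) * z * (\<Sum>i<l. (r * z) ^ i)" for z
  \<comment> \<open>At this point the first term of the sum alone gives the value \<open>1\<close>.\<close>
  define b where "b = 1 / (1 - r)"
  have b: "b > 0" "(1 - r) * b = 1" using assms by (auto simp: b_def)
  have "(r * b) ^ 0 \<le> (\<Sum>i<l. (r * b) ^ i)"
    using l_pos assms b by (intro member_le_sum) auto
  then have "1 \<le> f b" unfolding f_def b(2) by simp
  moreover have "f 0 \<le> 1" by (simp add: f_def)
  moreover have "continuous_on {0..b} f" unfolding f_def by (intro continuous_intros)
  ultimately obtain z where z: "0 \<le> z" "f z = 1" using IVT'[of f 0 1 b] b by auto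
  moreover have "z \<noteq> 0" using z by (auto simp: f_def)
  ultimately show ?thesis unfolding f_def by (intro exI[of _ z]) auto
qed

text \<open>After multiplication by \<open>z ^ n\<close> the weights in the renewal equation add up to \<open>1\<close>; this is
  the meaning of the equation for \<open>z\<close>.\<close>

lemma homogeneous_tail_asymp:
  assumes p: "\<And>i. i \<ge> 1 \<Longrightarrow> p i = r"
    and z: "z > 0" "(1 - r) * z * (\<Sum>i<l. (r * z) ^ i) = 1"
  shows "\<exists>c>0. t \<sim>[at_top] (\<lambda>n. c * z powi (- int n))"
proof -
  have r: "0 < r" "r < 1" using p_pos[of 1] p_less_1[of 1] p[of 1] by auto
  define f where "f i = (1 - r) * z * (r * z) ^ (l - Suc i)" for i
  define u where "u n = t n * z ^ n" for n
  have "\<exists>c>0. u \<longlonglongrightarrow> c"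
  proof (rule mean_recursion_converges[OF l_pos])
    show "0 < f i" for i using r z unfolding f_def by (intro mult_pos_pos zero_less_power) auto
    have "(\<Sum>i<l. f i) = (1 - r) * z * (\<Sum>i<l. (r * z) ^ (l - Suc i))"
      by (simp add: f_def sum_distrib_left)
    also have "(\<Sum>i<l. (r * z) ^ (l - Suc i)) = (\<Sum>i<l. (r * z) ^ i)"
      by (rule sum.nat_diff_reindex)
    finally show "(\<Sum>i<l. f i) = 1" using z by simp
    show "0 < u n" for n using z tail_pos unfolding u_def by simp
    show "u (n + l) = (\<Sum>i<l. f i * u (n + i))" for n
    proof -
      have "(\<Sum>i<l. f i * u (n + i)) = (\<Sum>i<l. f (l - Suc i) * u (n + (l - Suc i)))"
        by (rule sum.nat_diff_reindex[symmetric])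
      also have "\<dots> = (\<Sum>i<l. (1 - r) * (r ^ i * t (n + l - Suc i)) * z ^ (n + l))"
      proof (rule sum.cong[OF refl])
        fix i assume i: "i \<in> {..<l}"
        have *: "n + (l - Suc i) = n + l - Suc i" "l - Suc (l - Suc i) = i" using i by auto
        have "z * z ^ i * z ^ (n + l - Suc i) = z ^ (n + l)"
          using i by (simp flip: power_Suc power_add)
        then show "f (l - Suc i) * u (n + (l - Suc i)) =
            (1 - r) * (r ^ i * t (n + l - Suc i)) * z ^ (n + l)"
          unfolding f_def u_def * power_mult_distrib by (simp add: mult.assoc mult.left_commute)
      qed
      also have "\<dots> = (1 - r) * (\<Sum>i<l. r ^ i * t (n + l - Suc i)) * z ^ (n + l)"
        by (simp add: sum_distrib_left sum_distrib_right)
      also have "\<dots> = u (n + l)"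
        using homogeneous_renewal[OF p, of "n + l"] l_pos by (simp add: u_def)
      finally show ?thesis by simp
    qed
  qed
  then obtain c where c: "c > 0" "u \<longlonglongrightarrow> c" by blast
  have "(\<lambda>n. u n / c) \<longlonglongrightarrow> c / c" using c by (intro tendsto_intros) auto
  moreover have "u n / c = t n / (c * z powi (- int n))" for n
    using z c by (simp add: u_def power_int_minus field_simps)
  ultimately have "t \<sim>[at_top] (\<lambda>n. c * z powi (- int n))"
    using c by (intro asymp_equivI') simp
  with c show ?thesis by blast
qed


section \<open>Logarithmic asymptotics\<close>

text \<open>The one-lag bounds determine the increment of \<open>ln \<circ> t\<close> over \<open>l\<close> steps up to a factor
  tending to \<open>1\<close>. Summing \<open>ln \<circ> t\<close> over windows of length \<open>l\<close> turns this into information on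
  one-step increments, to which the Stolz--Cesaro theorem applies; since \<open>t\<close> is decreasing, the
  window sums enclose \<open>l * ln (t n)\<close>.\<close>

lemma short_tail_log_asymp:
  assumes ab: "a > 0" "b > 0" and p: "\<And>i. i \<ge> 1 \<Longrightarrow> p i = exp (- a * real i powr (- b))"
  shows "t \<approx>log (\<lambda>n. exp (- b * real n * ln (real n) / real l))"
proof -
  define y where "y n = b * real n * ln (real n)" for n
  define S where "S n = (\<Sum>i<l. - ln (t (n + i)))" for n
  have y_inc: "y n < y (Suc n)" if "n \<ge> 1" for n
  proof -
    have "real n * ln (real n) \<le> real n * ln (real (Suc n))"
      using that by (intro mult_left_mono) auto
    also have "\<dots> < real (Suc n) * ln (real (Suc n))" using that by (intro mult_strict_right_mono) auto
    finally show ?thesis using ab unfolding y_def by (simp add: mult.assoc)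
  qed
  have y_top: "filterlim y at_top sequentially" unfolding y_def using ab by real_asymp
  have S_Suc: "S (Suc n) - S n = ln (t n) - ln (t (n + l))" for n
    using sum_lessThan_telescope[of "\<lambda>i. - ln (t (n + i))" l]
    by (simp add: S_def sum_subtractf sum_negf)
  have p_lt: "p (n + l) < 1" "0 < p (n + l)" "p (n + l) ^ l < 1" for n
    using p_pos[of "n + l"] p_less_1[of "n + l"] l_pos by (auto simp: power_less_one_iff)
  have upper: "S (Suc n) - S n \<le> - ln (1 - p (n + l))" for n
  proof -
    have "ln ((1 - p (n + l)) * t n) \<le> ln (t (n + l))"
      using lag_ge[of n] tail_pos p_lt[of n] by (intro ln_mono) auto
    then show ?thesis using tail_pos[of n] p_lt[of n] unfolding S_Suc by (simp add: ln_mult)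
  qed
  have lower: "- ln (1 - p (n + l) ^ l) \<le> S (Suc n) - S n" for n
  proof -
    have "p (n + l) ^ l = (\<Prod>j\<in>{n+l..n+(2*l-1)}. p (n + l))" using l_pos by simp
    also have "\<dots> \<le> (\<Prod>j\<in>{n+l..n+(2*l-1)}. p j)"
    proof (rule prod_mono)
      fix j assume j: "j \<in> {n+l..n+(2*l-1)}"
      have "real j powr (- b) \<le> real (n + l) powr (- b)"
        using j ab l_pos by (intro powr_mono2') auto
      then have "p (n + l) \<le> p j" using p[of j] p[of "n + l"] j l_pos ab by auto
      then show "0 \<le> p (n + l) \<and> p (n + l) \<le> p j" using p_lt[of n] by simp
    qed
    finally have "t n * (1 - (\<Prod>j\<in>{n+l..n+(2*l-1)}. p j)) \<le> t n * (1 - p (n + l) ^ l)"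
      using tail_pos[of n] by (intro mult_left_mono) auto
    with lag_le[of n] have "t (n + l) \<le> t n * (1 - p (n + l) ^ l)" by (rule order_trans)
    then have "ln (t (n + l)) \<le> ln (t n * (1 - p (n + l) ^ l))"
      using tail_pos[of "n + l"] by (intro ln_mono)
    then show ?thesis using tail_pos[of n] p_lt[of n] unfolding S_Suc by (simp add: ln_mult)
  qed
  have S_lim: "(\<lambda>n. S n / y n) \<longlonglongrightarrow> 1"
  proof (rule stolz_cesaro[OF y_inc y_top])
    \<comment> \<open>A factor \<open>c\<close> in the exponent shifts the logarithm by an asymptotically constant amount. The upper
      bound has \<open>c = 1\<close> and the lower one \<open>c = l\<close>.\<close>
    have lim: "(\<lambda>n. - ln (1 - exp (- (a * c) * (real n + real l) powr (- b))) / (y (Suc n) - y n))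
        \<longlonglongrightarrow> 1" if "c > 0" for c :: real
      unfolding y_def using ab that by real_asymp
    show "(\<lambda>n. (S (Suc n) - S n) / (y (Suc n) - y n)) \<longlonglongrightarrow> 1"
    proof (rule tendsto_sandwich)
      have "p (n + l) ^ l = exp (- (a * real l) * (real n + real l) powr (- b))" for n
        using p[of "n + l"] l_pos by (simp add: ac_simps flip: exp_of_nat_mult)
      then show "\<forall>\<^sub>F n in sequentially.
          - ln (1 - exp (- (a * real l) * (real n + real l) powr (- b))) / (y (Suc n) - y n)
          \<le> (S (Suc n) - S n) / (y (Suc n) - y n)"
        using lower y_inc
        by (intro eventually_sequentiallyI[of 1] divide_right_mono) (auto simp: less_imp_le)
      show "(\<lambda>n. - ln (1 - exp (- (a * real l) * (real n + real l) powr (- b)))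
          / (y (Suc n) - y n)) \<longlonglongrightarrow> 1"
        using l_pos by (intro lim) simp
      have "p (n + l) = exp (- (a * 1) * (real n + real l) powr (- b))" for n
        using p[of "n + l"] l_pos by simp
      then show "\<forall>\<^sub>F n in sequentially. (S (Suc n) - S n) / (y (Suc n) - y n)
          \<le> - ln (1 - exp (- (a * 1) * (real n + real l) powr (- b))) / (y (Suc n) - y n)"
        using upper y_inc
        by (intro eventually_sequentiallyI[of 1] divide_right_mono) (auto simp: less_imp_le)
      show "(\<lambda>n. - ln (1 - exp (- (a * 1) * (real n + real l) powr (- b)))
          / (y (Suc n) - y n)) \<longlonglongrightarrow> 1"
        by (intro lim) simp
    qed
  qed simp
  have ln_mono_tail: "ln (t n) \<le> ln (t m)" if "m \<le> n" for m n
    using that tail_pos by (intro ln_mono tail_antimono) auto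
  have S_le: "S n \<le> real l * - ln (t (n + l))" for n
    unfolding S_def using sum_bounded_above[of "{..<l}" "\<lambda>i. - ln (t (n + i))" "- ln (t (n + l))"]
      ln_mono_tail by simp
  have S_ge: "real l * - ln (t n) \<le> S n" for n
    unfolding S_def using sum_bounded_below[of "{..<l}" "- ln (t n)" "\<lambda>i. - ln (t (n + i))"]
      ln_mono_tail by simp
  have y_pos: "y (n + l) > 0" if "n \<ge> 1" for n
    unfolding y_def using that ab l_pos by (intro mult_pos_pos) auto
  have "(\<lambda>n. real l * - ln (t (n + l)) / y (n + l)) \<longlonglongrightarrow> 1"
  proof (rule tendsto_sandwich)
    show "\<forall>\<^sub>F n in sequentially. S n / y (n + l) \<le> real l * - ln (t (n + l)) / y (n + l)"
      using S_le y_pos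
      by (intro eventually_sequentiallyI[of 1] divide_right_mono) (auto simp: less_imp_le)
    show "\<forall>\<^sub>F n in sequentially. real l * - ln (t (n + l)) / y (n + l) \<le> S (n + l) / y (n + l)"
      using S_ge y_pos
      by (intro eventually_sequentiallyI[of 1] divide_right_mono) (auto simp: less_imp_le)
    show "(\<lambda>n. S (n + l) / y (n + l)) \<longlonglongrightarrow> 1"
      using S_lim by (rule LIMSEQ_ignore_initial_segment)
    have "(\<lambda>n. y n / y (n + l)) \<longlonglongrightarrow> 1" unfolding y_def of_nat_add using ab by real_asymp
    with S_lim have "(\<lambda>n. S n / y n * (y n / y (n + l))) \<longlonglongrightarrow> 1 * 1" by (rule tendsto_mult)
    then have lim: "(\<lambda>n. S n / y n * (y n / y (n + l))) \<longlonglongrightarrow> 1" by simp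
    have "\<forall>\<^sub>F n in sequentially. 0 < y n"
      using y_top unfolding filterlim_at_top_dense by blast
    then have "\<forall>\<^sub>F n in sequentially. S n / y n * (y n / y (n + l)) = S n / y (n + l)"
      by eventually_elim simp
    then show "(\<lambda>n. S n / y (n + l)) \<longlonglongrightarrow> 1" by (rule Lim_transform_eventually[OF lim])
  qed
  then have "(\<lambda>n. real l * - ln (t n) / y n) \<longlonglongrightarrow> 1" by (rule LIMSEQ_offset)
  then show ?thesis unfolding log_equiv_def y_def using l_pos by (simp add: field_simps)
qed

text \<open>Here \<open>p\<close> tends to \<open>0\<close>, so that the tail changes by a vanishing proportion over \<open>l\<close> steps and
  the recursion gives the increment of \<open>ln \<circ> t\<close> at \<open>n\<close> as asymptotically \<open>- w n\<close>.\<close>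

lemma long_tail_log_asymp:
  assumes b: "0 < b" "b < 1 / real l" and p: "\<And>i. i \<ge> 2 \<Longrightarrow> p i = real i powr (- b)"
  shows "t \<approx>log (\<lambda>n. exp (- (real n powr (1 - b * real l) / (1 - b * real l))))"
proof -
  define s where "s = 1 - b * real l"
  have s: "0 < s" "s < 1" using b l_pos by (auto simp: s_def field_simps)
  define y where "y n = real n powr s / s" for n
  \<comment> \<open>Since \<open>s - 1 = - b * l\<close>, this is the size of \<open>w n\<close>; it is also that of the increments
    of \<open>y\<close>, whose derivative it is.\<close>
  define h where "h n = real n powr (s - 1)" for n
  define v where "v n = w n * (t (n - l) / t n)" for n
  have y_inc: "y n < y (Suc n)" for n
    unfolding y_def using s by (intro divide_strict_right_mono powr_less_mono2) auto
  have y_top: "filterlim y at_top sequentially" unfolding y_def using s by real_asymp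
  have "(\<lambda>n. real n powr (- b)) \<longlonglongrightarrow> 0" using b by real_asymp
  then have p_lim: "p \<longlonglongrightarrow> 0"
    by (rule Lim_transform_eventually) (use p in \<open>auto intro!: eventually_sequentiallyI[of 2]\<close>)
  have w_lim: "(\<lambda>n. w n / h n) \<longlonglongrightarrow> 1"
  proof -
    have "(\<lambda>n. (1 - p n) * (\<Prod>i\<in>{1..l}. (real n + real i) powr (- b) / real n powr (- b)))
        \<longlonglongrightarrow> (1 - 0) * (\<Prod>i\<in>{1..l}. 1)"
    proof (intro tendsto_mult tendsto_diff tendsto_const p_lim tendsto_prod)
      fix i
      show "(\<lambda>n. (real n + real i) powr (- b) / real n powr (- b)) \<longlonglongrightarrow> 1"
        using b by real_asymp
    qed
    then have lim: "(\<lambda>n. (1 - p n) * (\<Prod>i\<in>{1..l}. (real n + real i) powr (- b) / real n powr (- b)))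
        \<longlonglongrightarrow> 1" by simp
    have "(1 - p n) * (\<Prod>i\<in>{1..l}. (real n + real i) powr (- b) / real n powr (- b)) = w n / h n"
      if n: "n \<ge> 2" for n
    proof -
      have "(\<Prod>j\<in>{n+1..n+l}. p j) = (\<Prod>i\<in>{1..l}. p (n + i))"
        using prod.shift_bounds_cl_nat_ivl[of p 1 n l] by (simp add: add.commute)
      also have "\<dots> = (\<Prod>i\<in>{1..l}. (real n + real i) powr (- b))"
        using n p by (intro prod.cong) auto
      finally have "w n = (1 - p n) * (\<Prod>i\<in>{1..l}. (real n + real i) powr (- b))"
        by (simp add: w_def)
      moreover have "h n = (real n powr (- b)) ^ l"
        using n by (simp add: h_def s_def powr_powr flip: powr_realpow)
      ultimately show ?thesis by (simp add: prod_dividef)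
    qed
    then show ?thesis
      by (intro Lim_transform_eventually[OF lim] eventually_sequentiallyI[of 2]) auto
  qed
  have t_lim: "(\<lambda>n. t (n - l) / t n) \<longlonglongrightarrow> 1"
  proof -
    have "(\<lambda>i. inverse (t (i + l) / t i)) \<longlonglongrightarrow> inverse 1"
      by (intro tendsto_inverse long_tail p_lim) simp
    then have "(\<lambda>i. t (i + l - l) / t (i + l)) \<longlonglongrightarrow> 1" by simp
    then show ?thesis by (rule LIMSEQ_offset)
  qed
  have v_h: "(\<lambda>n. v n / h n) \<longlonglongrightarrow> 1"
    using tendsto_mult[OF w_lim t_lim] by (simp add: v_def mult.commute)
  have h_0: "h \<longlonglongrightarrow> 0" unfolding h_def using s by real_asymp
  have h_pos: "h n > 0" if "n \<ge> 1" for n using that by (simp add: h_def)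
  have v_pos: "v n > 0" if "n \<ge> 1" for n
    unfolding v_def using that tail_pos w_pos by simp
  have v_0: "v \<longlonglongrightarrow> 0"
  proof -
    have "(\<lambda>n. v n / h n * h n) \<longlonglongrightarrow> 1 * 0" by (intro tendsto_mult v_h h_0)
    then have lim: "(\<lambda>n. v n / h n * h n) \<longlonglongrightarrow> 0" by (simp only: mult_zero_right)
    have "v n / h n * h n = v n" if "n \<ge> 1" for n using h_pos[OF that] by simp
    then show ?thesis
      by (intro Lim_transform_eventually[OF lim] eventually_sequentiallyI[of 1])
  qed
  have "filterlim v (at 0) sequentially"
    unfolding filterlim_at using v_0 v_pos
    by (auto intro!: eventually_sequentiallyI[of 1] simp: less_imp_neq[symmetric])
  moreover have "((\<lambda>x::real. - ln (1 - x) / x) \<longlongrightarrow> 1) (at 0)" by real_asymp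
  ultimately have ln_v: "(\<lambda>n. - ln (1 - v n) / v n) \<longlonglongrightarrow> 1"
    by (rule filterlim_compose[rotated])
  have h_y: "(\<lambda>n. h n / (y (Suc n) - y n)) \<longlonglongrightarrow> 1"
    unfolding h_def y_def using s by real_asymp
  have "(\<lambda>n. - ln (t n) / y n) \<longlonglongrightarrow> 1"
  proof (rule stolz_cesaro[OF y_inc y_top])
    have "(\<lambda>n. (- ln (1 - v n) / v n) * (v n / h n) * (h n / (y (Suc n) - y n))) \<longlonglongrightarrow> 1 * 1 * 1"
      by (intro tendsto_mult ln_v v_h h_y)
    then have lim: "(\<lambda>n. (- ln (1 - v n) / v n) * (v n / h n) * (h n / (y (Suc n) - y n))) \<longlonglongrightarrow> 1"
      by simp
    have "(- ln (1 - v n) / v n) * (v n / h n) * (h n / (y (Suc n) - y n)) =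
        (- ln (t (Suc n)) - - ln (t n)) / (y (Suc n) - y n)" if n: "n \<ge> 1" for n
    proof -
      have "t (Suc n) = t n * (1 - v n)"
        using tail_Suc[OF n] tail_pos[of n] by (simp add: v_def right_diff_distrib)
      moreover from this have "1 - v n > 0"
        using tail_pos[of n] tail_pos[of "Suc n"] by (simp add: zero_less_mult_iff)
      ultimately have "ln (t (Suc n)) = ln (t n) + ln (1 - v n)"
        using tail_pos[of n] by (simp add: ln_mult)
      then show ?thesis using v_pos[OF n] h_pos[OF n] by simp
    qed
    then show "(\<lambda>n. (- ln (t (Suc n)) - - ln (t n)) / (y (Suc n) - y n)) \<longlonglongrightarrow> 1"
      by (intro Lim_transform_eventually[OF lim] eventually_sequentiallyI[of 1]) auto
  qed
  then show ?thesis unfolding log_equiv_def y_def s_def by simp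
qed

lemma shifted_first_run_iff:
  "enat n < first_run \<xi> l \<omega> + enat l \<longleftrightarrow> enat (n - l) < first_run \<xi> l \<omega>"
proof -
  \<comment> \<open>Runs start at \<open>1\<close> or later, which settles the case \<open>n < l\<close>.\<close>
  have "enat 0 < first_run \<xi> l \<omega>" unfolding first_run_gt_iff by simp
  then show ?thesis by (cases "first_run \<xi> l \<omega>") auto
qed

end

section \<open>Time of the first run\<close>

theorem corollary7p1:
  fixes M :: "'a measure" and \<xi> :: "nat \<Rightarrow> 'a \<Rightarrow> nat" and p :: "nat \<Rightarrow> real" and l :: nat
  assumes "bernoulli_seq M \<xi> p"
    and "\<forall>i\<ge>1. 0 < p i \<and> p i < 1"
    and "l \<ge> 1"
  shows
    \<comment> \<open>(i): \<open>D + l > n\<close> is \<open>D > n - l\<close> without truncated subtraction\<close>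
    "(\<forall>n\<ge>1. \<P>(\<omega> in M. first_run \<xi> l \<omega> = enat (n + 1)) =
        (1 - p n) * \<P>(\<omega> in M. first_run \<xi> l \<omega> + enat l > enat n) * (\<Prod>j\<in>{n+1..n+l}. p j)) \<and>
     \<comment> \<open>(ii)\<close>
     (if summable (\<lambda>i. 1 - p (Suc i)) \<or> run_series p l = \<infinity>
      then AE \<omega> in M. first_run \<xi> l \<omega> < \<infinity>
      else \<P>(\<omega> in M. first_run \<xi> l \<omega> = \<infinity>) > 0) \<and>
     \<comment> \<open>(iii), first part restricted to divergent \<open>\<Sum>i. 1 - p i\<close>\<close>
     (limsup (\<lambda>i. ereal (- ln (p i) / ln (real i))) < ereal (1 / real l) \<longrightarrow>
        \<not> summable (\<lambda>i. 1 - p (Suc i)) \<longrightarrow> run_series p l = \<infinity>) \<and>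
     (liminf (\<lambda>i. ereal (- ln (p i) / ln (real i))) > ereal (1 / real l) \<longrightarrow>
        run_series p l < \<infinity>) \<and>
     \<comment> \<open>(iv)\<close>
     (\<forall>n\<ge>l.
        (p \<longlonglongrightarrow> 1 \<longrightarrow> (\<lambda>i. run_tail M \<xi> l (i + n) / run_tail M \<xi> l i) \<longlonglongrightarrow> 0) \<and>
        (p \<longlonglongrightarrow> 0 \<longrightarrow> (\<lambda>i. run_tail M \<xi> l (i + n) / run_tail M \<xi> l i) \<longlonglongrightarrow> 1)) \<and>
     \<comment> \<open>(v)\<close>
     (\<forall>r. (\<forall>i\<ge>1. p i = r) \<longrightarrow>
        (\<exists>z>0. (1 - r) * z * (\<Sum>i<l. (r * z) ^ i) = 1) \<and>
        (\<forall>z>0. (1 - r) * z * (\<Sum>i<l. (r * z) ^ i) = 1 \<longrightarrow>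
           (\<exists>c1>0. run_tail M \<xi> l \<sim>[at_top] (\<lambda>n. c1 * z powi (- int n))))) \<and>
     \<comment> \<open>(vi)\<close>
     (\<forall>a>0. \<forall>b>0. (\<forall>i\<ge>1. p i = exp (- a * real i powr (- b))) \<longrightarrow>
        run_tail M \<xi> l \<approx>log (\<lambda>n. exp (- b * real n * ln (real n) / real l))) \<and>
     \<comment> \<open>(vii)\<close>
     (\<forall>b. 0 < b \<and> b < 1 / real l \<and> (\<forall>i\<ge>2. p i = real i powr (- b)) \<longrightarrow>
        run_tail M \<xi> l \<approx>log
          (\<lambda>n. exp (- (real n powr (1 - b * real l) / (1 - b * real l)))))"
proof -
  interpret bernoulli_runs M \<xi> p l
    using assms unfolding bernoulli_seq_def
    by (intro bernoulli_runs.intro bernoulli_runs_axioms.intro) auto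
  have i: "\<forall>n\<ge>1. prob {\<omega> \<in> space M. first_run \<xi> l \<omega> = enat (n + 1)} =
      (1 - p n) * prob {\<omega> \<in> space M. first_run \<xi> l \<omega> + enat l > enat n} * (\<Prod>j\<in>{n+1..n+l}. p j)"
    using prob_first_run unfolding shifted_first_run_iff w_def run_tail_def by (simp add: ac_simps)
  have ii: "if summable (\<lambda>i. 1 - p (Suc i)) \<or> run_series p l = \<infinity>
      then AE \<omega> in M. first_run \<xi> l \<omega> < \<infinity>
      else prob {\<omega> \<in> space M. first_run \<xi> l \<omega> = \<infinity>} > 0"
    using AE_finite_if_tail_tendsto_0[OF tail_tendsto_0_if_summable]
      AE_finite_if_tail_tendsto_0[OF tail_tendsto_0_if_series_infinite] tail_limit_pos
    unfolding run_series_infinite_iff by (simp split: if_split)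
  have iii: "limsup (\<lambda>i. ereal (- ln (p i) / ln (real i))) < ereal (1 / real l) \<longrightarrow>
      \<not> summable (\<lambda>i. 1 - p (Suc i)) \<longrightarrow> run_series p l = \<infinity>"
    unfolding run_series_infinite_iff using series_infinite_if_slow_decay by blast
  have iii': "liminf (\<lambda>i. ereal (- ln (p i) / ln (real i))) > ereal (1 / real l) \<longrightarrow>
      run_series p l < \<infinity>"
    using series_finite_if_fast_decay run_series_infinite_iff by (auto simp: top.not_eq_extremum)
  have iv: "\<forall>n\<ge>l.
      (p \<longlonglongrightarrow> 1 \<longrightarrow> (\<lambda>i. t (i + n) / t i) \<longlonglongrightarrow> 0) \<and>
      (p \<longlonglongrightarrow> 0 \<longrightarrow> (\<lambda>i. t (i + n) / t i) \<longlonglongrightarrow> 1)"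
    using short_tail long_tail by blast
  have v: "\<forall>r. (\<forall>i\<ge>1. p i = r) \<longrightarrow>
      (\<exists>z>0. (1 - r) * z * (\<Sum>i<l. (r * z) ^ i) = 1) \<and>
      (\<forall>z>0. (1 - r) * z * (\<Sum>i<l. (r * z) ^ i) = 1 \<longrightarrow>
         (\<exists>c1>0. t \<sim>[at_top] (\<lambda>n. c1 * z powi (- int n))))"
  proof (intro allI impI)
    fix r assume r: "\<forall>i\<ge>1. p i = r"
    then have "0 < r" "r < 1" using p_pos[of 1] p_less_1[of 1] by auto
    with r show "(\<exists>z>0. (1 - r) * z * (\<Sum>i<l. (r * z) ^ i) = 1) \<and>
        (\<forall>z>0. (1 - r) * z * (\<Sum>i<l. (r * z) ^ i) = 1 \<longrightarrow>
           (\<exists>c1>0. t \<sim>[at_top] (\<lambda>n. c1 * z powi (- int n))))"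
      using characteristic_root_exists homogeneous_tail_asymp by blast
  qed
  have vi: "\<forall>a>0. \<forall>b>0. (\<forall>i\<ge>1. p i = exp (- a * real i powr (- b))) \<longrightarrow>
      t \<approx>log (\<lambda>n. exp (- b * real n * ln (real n) / real l))"
    using short_tail_log_asymp by blast
  have vii: "\<forall>b. 0 < b \<and> b < 1 / real l \<and> (\<forall>i\<ge>2. p i = real i powr (- b)) \<longrightarrow>
      t \<approx>log (\<lambda>n. exp (- (real n powr (1 - b * real l) / (1 - b * real l))))"
    using long_tail_log_asymp by blast
  show ?thesis by (intro conjI i ii iii iii' iv v vi vii)
qed

end
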